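(* In the time-homogeneous model described in the context, under the standing assumptions, as $n\to\infty$, $$\frac1n\sum_{0\le p<n}\mathrm{Cov}_{p,\eta_{p-1}}\left(\overline{Q}_{p,n}(1),\overline{Q}_{p,n}(1)\right)=\mathrm{Cov}_{\eta_\infty}(h,h)+\mathrm{O}(1/n).$$
   Context: Setting (time-homogeneous model). $(E,\mathcal{E})$ is a measurable space; $(X_n)_{n\ge0}$ is a Markov chain on $E$ with initial law $\eta_0$ and Markov transition kernel $M$; $G$ is a positive bounded measurable function on $E$ (so in the general Feynman-Kac notation $M_n=M$ for $n\ge1$ and $G_n=G$ for $n\ge0$). Write $\mu(f)=\int f\,d\mu$, $\mu K(dx')=\int\mu(dx)K(x,dx')$, $K(f)(x)=\int f(x')K(x,dx')$, $\|f\|=\sup_x|f(x)|$, $\mathrm{osc}(f)=\sup_{x,y}|f(x)-f(y)|$, and let $\mathrm{Osc}(E)$ be the set of measurable $f$ with $\mathrm{osc}(f)\le1$. Let $\gamma_n(f)=\mathbb{E}\big(f(X_n)\prod_{0\le p<n}G(X_p)\big)$ and $\eta_n(f)=\gamma_n(f)/\gamma_n(1)$. With $\Psi_G(\mu)(dx)=\frac1{\mu(G)}G(x)\mu(dx)$ and $\Phi(\mu)=\Psi_G(\mu)M$, one has $\eta_n=\Phi(\eta_{n-1})$. A family of Markov kernels $K_\mu$ ($\mu$ a probability measure on $E$) is given with $\Phi(\mu)=\mu K_\mu$; set $K_{n,\mu}=K_\mu$ for $n\ge1$, and by convention $K_{0,\mu}(x,\cdot)=\eta_0$ and $\eta_{-1}=\eta_0$.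 $\mathrm{Cov}_{n,\mu}(f_1,f_2)=\mu\big[K_{n,\mu}(f_1f_2)-K_{n,\mu}(f_1)K_{n,\mu}(f_2)\big]$; $\mathrm{Cov}_\mu$ denotes the common value of $\mathrm{Cov}_{n,\mu}$ for $n\ge1$. For $0\le p\le n$: $Q_{p,n}(f)(x)=\mathbb{E}\big(f(X_n)\prod_{p\le q<n}G(X_q)\,\big|\,X_p=x\big)$, $\overline{Q}_{p,n}(f)=Q_{p,n}(f)/\eta_p(Q_{p,n}(1))$, $P_{p,n}(f)=Q_{p,n}(f)/Q_{p,n}(1)$. The Dobrushin coefficient is $\beta(P)=\sup_{x,y\in E,\,f\in\mathrm{Osc}(E)}|P(f)(x)-P(f)(y)|$. Standing assumptions. (i) $g:=\sup G/\inf G<\infty$. (ii) $\beta(P_{p,n})\le a\,e^{-\lambda(n-p)}$ for all $0\le p\le n$, for some finite $a$ and some $\lambda>0$. (iii) There is a finite $\kappa$ such that for all probability measures $\mu_1,\mu_2$ on $E$ and all $f\in\mathrm{Osc}(E)$, $\|[K_{\mu_1}-K_{\mu_2}](f)\|\le\kappa\,|(\mu_1-\mu_2)(T(f,\mu_2))|$, where $T(f,\mu_2)\in\mathrm{Osc}(E)$ may depend on $f,\mu_2$ (but not on $\mu_1$). Under these assumptions $\Phi$ has a unique fixed point $\eta_\infty=\Phi(\eta_\infty)$ among probability measures. The function $h$ is defined by $\log h(x)=\sum_{n\ge0}\left[\log\Phi^n(\delta_x)(G)-\log\Phi^n(\eta_\infty)(G)\right]$, where $\Phi^n$ is the $n$-fold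 iterate of $\Phi$. *)

theory Defs
  imports "HOL-Probability.Probability" "HOL-Library.Landau_Symbols"
begin

text \<open>
  The measurable space is the pair of \<open>space E\<close> and \<open>sets E\<close> for some \<open>E :: 'a measure\<close>; the
  measure carried by \<open>E\<close> plays no role. Probability measures are the elements of
  \<open>space (prob_algebra E)\<close>, Markov kernels the elements of \<open>E \<rightarrow>\<^sub>M prob_algebra E\<close>, and the
  composition of a measure and a kernel is \<open>\<bind>\<close>. Suprema that could be infinite are taken in
  \<open>ereal\<close>, since \<open>Sup\<close> on \<open>real\<close> is unspecified for unbounded sets.
\<close>

definition kernel_op :: "('a \<Rightarrow> 'a measure) \<Rightarrow> ('a \<Rightarrow> real) \<Rightarrow> 'a \<Rightarrow> real" where
  "kernel_op K f x = (\<integral>y. f y \<partial>K x)"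

definition sup_norm :: "'a measure \<Rightarrow> ('a \<Rightarrow> real) \<Rightarrow> ereal" where
  "sup_norm E f = (SUP x\<in>space E. ereal \<bar>f x\<bar>)"

definition osc :: "'a measure \<Rightarrow> ('a \<Rightarrow> real) \<Rightarrow> ereal" where
  "osc E f = (SUP x\<in>space E. SUP y\<in>space E. ereal \<bar>f x - f y\<bar>)"

definition Osc :: "'a measure \<Rightarrow> ('a \<Rightarrow> real) set" where
  "Osc E = {f \<in> borel_measurable E. osc E f \<le> 1}"

definition dobrushin :: "'a measure \<Rightarrow> (('a \<Rightarrow> real) \<Rightarrow> 'a \<Rightarrow> real) \<Rightarrow> ereal" where
  "dobrushin E P = (SUP x\<in>space E. SUP y\<in>space E. SUP f\<in>Osc E. ereal \<bar>P f x - P f y\<bar>)"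

definition sup_inf_ratio :: "'a measure \<Rightarrow> ('a \<Rightarrow> real) \<Rightarrow> ereal" where
  "sup_inf_ratio E G = (SUP x\<in>space E. ereal (G x)) / (INF x\<in>space E. ereal (G x))"

text \<open>
  \<open>chain_law E M \<mu>\<close> is the law on the path space of the Markov chain with initial law \<open>\<mu>\<close> and
  transition kernel \<open>M\<close>, obtained from the Ionescu-Tulcea extension theorem; the chain itself is
  the coordinate process \<open>\<lambda>\<omega>. \<omega> n\<close>.
\<close>

definition chain_step :: "('a \<Rightarrow> 'a measure) \<Rightarrow> 'a measure \<Rightarrow> nat \<Rightarrow> (nat \<Rightarrow> 'a) \<Rightarrow> 'a measure" where
  "chain_step M \<mu> n \<omega> = (case n of 0 \<Rightarrow> \<mu> | Suc m \<Rightarrow> M (\<omega> m))"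

definition chain_law ::
    "'a measure \<Rightarrow> ('a \<Rightarrow> 'a measure) \<Rightarrow> 'a measure \<Rightarrow> (nat \<Rightarrow> 'a) measure" where
  "chain_law E M \<mu> =
     projective_family.lim UNIV (Ionescu_Tulcea.CI (chain_step M \<mu>) (\<lambda>_. E)) (\<lambda>_. E)"

lemma Ionescu_Tulcea_chain_step:
  assumes M: "M \<in> E \<rightarrow>\<^sub>M prob_algebra E" and \<mu>: "\<mu> \<in> space (prob_algebra E)"
  shows "Ionescu_Tulcea (chain_step M \<mu>) (\<lambda>_. E)"
proof -
  have *: "chain_step M \<mu> n \<in> PiM {0..<n} (\<lambda>_. E) \<rightarrow>\<^sub>M prob_algebra E" for n
  proof (cases n)
    case 0
    then show ?thesis using \<mu> by (simp add: chain_step_def[abs_def])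
  next
    case (Suc m)
    have "(\<lambda>\<omega>. \<omega> m) \<in> PiM {0..<n} (\<lambda>_. E) \<rightarrow>\<^sub>M E"
      by (rule measurable_component_singleton) (simp add: Suc)
    from measurable_compose[OF this M] show ?thesis
      by (simp add: Suc chain_step_def[abs_def])
  qed
  show ?thesis
  proof (rule Ionescu_Tulcea.intro)
    show "chain_step M \<mu> n \<in> PiM {0..<n} (\<lambda>_. E) \<rightarrow>\<^sub>M subprob_algebra E" for n
      using * by (rule measurable_prob_algebraD)
    show "prob_space (chain_step M \<mu> n \<omega>)" if "\<omega> \<in> space (PiM {0..<n} (\<lambda>_. E))" for n \<omega>
      using measurable_space[OF * that] by (simp add: space_prob_algebra)
  qed
qed

text \<open>
  The unnormalised flow as a measure: integrating \<open>f\<close> against \<open>fk_gamma E M G \<eta>\<^sub>0 n\<close> gives the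
  expectation of \<open>f (X n) * (\<Prod>p<n. G (X p))\<close> for the chain started from \<open>\<eta>\<^sub>0\<close>.
\<close>

definition fk_gamma ::
    "'a measure \<Rightarrow> ('a \<Rightarrow> 'a measure) \<Rightarrow> ('a \<Rightarrow> real) \<Rightarrow> 'a measure \<Rightarrow> nat \<Rightarrow> 'a measure" where
  "fk_gamma E M G \<eta>\<^sub>0 n =
     distr (density (chain_law E M \<eta>\<^sub>0) (\<lambda>\<omega>. ennreal (\<Prod>p<n. G (\<omega> p)))) E (\<lambda>\<omega>. \<omega> n)"

definition fk_eta ::
    "'a measure \<Rightarrow> ('a \<Rightarrow> 'a measure) \<Rightarrow> ('a \<Rightarrow> real) \<Rightarrow> 'a measure \<Rightarrow> nat \<Rightarrow> 'a measure" where
  "fk_eta E M G \<eta>\<^sub>0 n =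
     scale_measure (1 / emeasure (fk_gamma E M G \<eta>\<^sub>0 n) (space E)) (fk_gamma E M G \<eta>\<^sub>0 n)"

definition boltzmann_gibbs :: "('a \<Rightarrow> real) \<Rightarrow> 'a measure \<Rightarrow> 'a measure" where
  "boltzmann_gibbs G \<mu> = density \<mu> (\<lambda>x. ennreal (G x / (\<integral>y. G y \<partial>\<mu>)))"

definition fk_Phi :: "('a \<Rightarrow> 'a measure) \<Rightarrow> ('a \<Rightarrow> real) \<Rightarrow> 'a measure \<Rightarrow> 'a measure" where
  "fk_Phi M G \<mu> = boltzmann_gibbs G \<mu> \<bind> M"

text \<open>
  The conditional expectation given \<open>X p = x\<close> is the expectation for the chain that starts in
  \<open>x\<close> at time \<open>p\<close>; its state at time \<open>q \<ge> p\<close> is the coordinate \<open>q - p\<close> of the path started from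
  the point mass at \<open>x\<close>.
\<close>

definition fk_Q ::
    "'a measure \<Rightarrow> ('a \<Rightarrow> 'a measure) \<Rightarrow> ('a \<Rightarrow> real) \<Rightarrow> nat \<Rightarrow> nat \<Rightarrow> ('a \<Rightarrow> real) \<Rightarrow> 'a \<Rightarrow> real" where
  "fk_Q E M G p n f x =
     (\<integral>\<omega>. f (\<omega> (n - p)) * (\<Prod>q=p..<n. G (\<omega> (q - p))) \<partial>chain_law E M (return E x))"

definition fk_Qbar ::
    "'a measure \<Rightarrow> ('a \<Rightarrow> 'a measure) \<Rightarrow> ('a \<Rightarrow> real) \<Rightarrow> 'a measure \<Rightarrow> nat \<Rightarrow> nat
       \<Rightarrow> ('a \<Rightarrow> real) \<Rightarrow> 'a \<Rightarrow> real" where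
  "fk_Qbar E M G \<eta>\<^sub>0 p n f x =
     fk_Q E M G p n f x / (\<integral>y. fk_Q E M G p n (\<lambda>_. 1) y \<partial>fk_eta E M G \<eta>\<^sub>0 p)"

definition fk_P ::
    "'a measure \<Rightarrow> ('a \<Rightarrow> 'a measure) \<Rightarrow> ('a \<Rightarrow> real) \<Rightarrow> nat \<Rightarrow> nat \<Rightarrow> ('a \<Rightarrow> real) \<Rightarrow> 'a \<Rightarrow> real" where
  "fk_P E M G p n f x = fk_Q E M G p n f x / fk_Q E M G p n (\<lambda>_. 1) x"

definition mckean_kernel ::
    "('a measure \<Rightarrow> 'a \<Rightarrow> 'a measure) \<Rightarrow> 'a measure \<Rightarrow> nat \<Rightarrow> 'a measure \<Rightarrow> 'a \<Rightarrow> 'a measure" where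
  "mckean_kernel K \<eta>\<^sub>0 n \<mu> = (if n = 0 then (\<lambda>_. \<eta>\<^sub>0) else K \<mu>)"

definition kernel_cov ::
    "('a \<Rightarrow> 'a measure) \<Rightarrow> 'a measure \<Rightarrow> ('a \<Rightarrow> real) \<Rightarrow> ('a \<Rightarrow> real) \<Rightarrow> real" where
  "kernel_cov L \<mu> f\<^sub>1 f\<^sub>2 =
     (\<integral>x. kernel_op L (\<lambda>y. f\<^sub>1 y * f\<^sub>2 y) x - kernel_op L f\<^sub>1 x * kernel_op L f\<^sub>2 x \<partial>\<mu>)"

definition fk_Cov ::
    "('a measure \<Rightarrow> 'a \<Rightarrow> 'a measure) \<Rightarrow> 'a measure \<Rightarrow> nat \<Rightarrow> 'a measure
       \<Rightarrow> ('a \<Rightarrow> real) \<Rightarrow> ('a \<Rightarrow> real) \<Rightarrow> real" where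
  "fk_Cov K \<eta>\<^sub>0 n \<mu> = kernel_cov (mckean_kernel K \<eta>\<^sub>0 n \<mu>) \<mu>"

definition fk_Cov_hom ::
    "('a measure \<Rightarrow> 'a \<Rightarrow> 'a measure) \<Rightarrow> 'a measure \<Rightarrow> ('a \<Rightarrow> real) \<Rightarrow> ('a \<Rightarrow> real) \<Rightarrow> real" where
  "fk_Cov_hom K \<mu> = kernel_cov (K \<mu>) \<mu>"

text \<open>The flow at time \<open>p - 1\<close>, with the convention that it is \<open>\<eta>\<^sub>0\<close> at time \<open>-1\<close>.\<close>

definition fk_eta_prev ::
    "'a measure \<Rightarrow> ('a \<Rightarrow> 'a measure) \<Rightarrow> ('a \<Rightarrow> real) \<Rightarrow> 'a measure \<Rightarrow> nat \<Rightarrow> 'a measure" where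
  "fk_eta_prev E M G \<eta>\<^sub>0 p = (case p of 0 \<Rightarrow> \<eta>\<^sub>0 | Suc m \<Rightarrow> fk_eta E M G \<eta>\<^sub>0 m)"

definition fk_eta_inf ::
    "'a measure \<Rightarrow> ('a \<Rightarrow> 'a measure) \<Rightarrow> ('a \<Rightarrow> real) \<Rightarrow> 'a measure" where
  "fk_eta_inf E M G = (THE \<eta>. \<eta> \<in> space (prob_algebra E) \<and> \<eta> = fk_Phi M G \<eta>)"

definition fk_h :: "'a measure \<Rightarrow> ('a \<Rightarrow> 'a measure) \<Rightarrow> ('a \<Rightarrow> real) \<Rightarrow> 'a \<Rightarrow> real" where
  "fk_h E M G x =
     exp (\<Sum>n. ln (\<integral>y. G y \<partial>((fk_Phi M G ^^ n) (return E x)))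
             - ln (\<integral>y. G y \<partial>((fk_Phi M G ^^ n) (fk_eta_inf E M G))))"

end

theory Submission
  imports Defs
begin

text \<open>
  Write \<open>Q\<close> for the operator \<open>f \<mapsto> G \<cdot> M f\<close> and \<open>q\<^sub>n = Q\<^sup>n 1\<close>. Integrating out the last step of the
  chain gives \<open>Q\<^bsub>p,n\<^esub> = Q\<^sup>n\<^sup>-\<^sup>p\<close> and \<open>\<Phi>\<^sup>n(\<mu>)(f) = \<mu>(Q\<^sup>n f) / \<mu>(q\<^sub>n)\<close>, an average of the ratios
  \<open>Q\<^sup>n f / q\<^sub>n = P\<^bsub>0,n\<^esub> f\<close>; so the Dobrushin bound makes \<open>\<Phi>\<^sup>n\<close> contract exponentially in total
  variation, uniformly in the initial law. This gives the fixed point \<open>\<eta>\<^sub>\<infinity>\<close>. With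
  \<open>\<rho> = \<eta>\<^sub>\<infinity>(G)\<close> the series defining \<open>log h\<close> telescopes to the limit of \<open>log (q\<^sub>n / \<rho>\<^sup>n)\<close>, with
  exponentially small remainder. Since \<open>\<eta>\<^sub>\<infinity>(q\<^sub>n) = \<rho>\<^sup>n\<close>, the normalised \<open>Q\<^bsub>p,n\<^esub>(1)\<close> differs from \<open>h\<close>
  uniformly by a constant times \<open>r\<^sup>p + r\<^sup>n\<^sup>-\<^sup>p\<close>, where \<open>r = e\<^sup>-\<^sup>\<lambda>\<close>. The regularity of \<open>\<mu> \<mapsto> K\<^sub>\<mu>\<close> passes
  this bound on to the covariances, and its sum over \<open>p < n\<close> stays bounded.
\<close>

section \<open>Bounded measurable functions\<close>

text \<open>The class is closed under products, differences and kernels, and each member is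
  integrable under every probability measure on \<open>E\<close>, so integrability needs no separate
  argument later. The bound is required on \<open>space E\<close> only.\<close>

definition bmeas :: "'a measure \<Rightarrow> ('a \<Rightarrow> real) set" where
  "bmeas E = {f \<in> borel_measurable E. \<exists>B. \<forall>x\<in>space E. \<bar>f x\<bar> \<le> B}"

lemma bmeasI: "f \<in> borel_measurable E \<Longrightarrow> (\<And>x. x \<in> space E \<Longrightarrow> \<bar>f x\<bar> \<le> B) \<Longrightarrow> f \<in> bmeas E"
  by (auto simp: bmeas_def)

lemma bmeas_measurable: "f \<in> bmeas E \<Longrightarrow> f \<in> borel_measurable E"
  by (simp add: bmeas_def)

text \<open>The bound is made strictly positive so that functions can be rescaled by dividing by
  it.\<close>

lemma bmeas_bound:
  assumes "f \<in> bmeas E"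
  obtains B where "B > 0" "\<And>x. x \<in> space E \<Longrightarrow> \<bar>f x\<bar> \<le> B"
proof -
  obtain B where "\<forall>x\<in>space E. \<bar>f x\<bar> \<le> B"
    using assms by (auto simp: bmeas_def)
  then show ?thesis
    by (intro that[of "\<bar>B\<bar> + 1"]) (auto intro: order_trans)
qed

lemma bmeas_const [simp]: "(\<lambda>_. c) \<in> bmeas E"
  by (rule bmeasI[where B="\<bar>c\<bar>"]) auto

lemma bmeas_indicator: "A \<in> sets E \<Longrightarrow> indicator A \<in> bmeas E"
  by (rule bmeasI[where B=1]) auto

lemma bmeas_mult:
  assumes "f \<in> bmeas E" "g \<in> bmeas E"
  shows "(\<lambda>x. f x * g x) \<in> bmeas E"
proof -
  obtain B where B: "B > 0" "\<And>x. x \<in> space E \<Longrightarrow> \<bar>f x\<bar> \<le> B"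
    using bmeas_bound[OF assms(1)] by blast
  obtain C where C: "C > 0" "\<And>x. x \<in> space E \<Longrightarrow> \<bar>g x\<bar> \<le> C"
    using bmeas_bound[OF assms(2)] by blast
  show ?thesis
    using assms B C
    by (intro bmeasI[where B="B * C"])
       (auto simp: abs_mult bmeas_measurable intro!: mult_mono borel_measurable_times)
qed

lemma bmeas_diff:
  assumes "f \<in> bmeas E" "g \<in> bmeas E"
  shows "(\<lambda>x. f x - g x) \<in> bmeas E"
proof -
  obtain B where B: "B > 0" "\<And>x. x \<in> space E \<Longrightarrow> \<bar>f x\<bar> \<le> B"
    using bmeas_bound[OF assms(1)] by blast
  obtain C where C: "C > 0" "\<And>x. x \<in> space E \<Longrightarrow> \<bar>g x\<bar> \<le> C"
    using bmeas_bound[OF assms(2)] by blast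
  show ?thesis
    using assms
    by (intro bmeasI[where B="B + C"])
       (auto simp: bmeas_measurable intro!: borel_measurable_diff abs_triangle_ineq4[THEN order_trans] add_mono B C)
qed

lemma bmeas_divide_const: "f \<in> bmeas E \<Longrightarrow> (\<lambda>x. f x / c) \<in> bmeas E"
  using bmeas_mult[of f E "\<lambda>_. 1 / c"] by simp

section \<open>Integrals of bounded functions under probability measures and kernels\<close>

lemma prob_algebraD:
  assumes "\<mu> \<in> space (prob_algebra E)"
  shows "prob_space \<mu>" "sets \<mu> = sets E" "space \<mu> = space E"
    "measurable \<mu> L = measurable E L"
  using assms by (auto simp: space_prob_algebra dest: sets_eq_imp_space_eq cong: measurable_cong_sets)

lemma bmeas_integrable:
  assumes "\<mu> \<in> space (prob_algebra E)" "f \<in> bmeas E"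
  shows "integrable \<mu> f"
proof -
  interpret prob_space \<mu> using assms prob_algebraD by auto
  obtain B where B: "B > 0" "\<And>x. x \<in> space E \<Longrightarrow> \<bar>f x\<bar> \<le> B"
    using bmeas_bound[OF assms(2)] by blast
  show ?thesis
    using assms B by (intro integrable_const_bound[where B=B])
      (auto simp: prob_algebraD bmeas_measurable)
qed

lemma prob_algebra_integral_const:
  "\<mu> \<in> space (prob_algebra E) \<Longrightarrow> (\<integral>x. c \<partial>\<mu>) = (c::real)"
  using prob_algebraD(1)[of \<mu> E] by (simp add: prob_space.prob_space)

lemma bmeas_integral_mono:
  assumes "\<mu> \<in> space (prob_algebra E)" "f \<in> bmeas E" "g \<in> bmeas E"
    "\<And>x. x \<in> space E \<Longrightarrow> f x \<le> g x"
  shows "(\<integral>x. f x \<partial>\<mu>) \<le> (\<integral>x. g x \<partial>\<mu>)"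
  using assms by (intro integral_mono bmeas_integrable) (auto simp: prob_algebraD)

lemma bmeas_integral_cong:
  assumes "\<mu> \<in> space (prob_algebra E)" "\<And>x. x \<in> space E \<Longrightarrow> f x = g x"
  shows "(\<integral>x. f x \<partial>\<mu>) = (\<integral>x. g x \<partial>\<mu>)"
  using assms by (intro Bochner_Integration.integral_cong) (auto simp: prob_algebraD)

lemma bmeas_integral_ge:
  assumes "\<mu> \<in> space (prob_algebra E)" "f \<in> bmeas E" "\<And>x. x \<in> space E \<Longrightarrow> c \<le> f x"
  shows "c \<le> (\<integral>x. f x \<partial>\<mu>)"
  using bmeas_integral_mono[OF assms(1) bmeas_const assms(2), of c] assms
  by (simp only: prob_algebra_integral_const)

lemma bmeas_integral_le:
  assumes "\<mu> \<in> space (prob_algebra E)" "f \<in> bmeas E" "\<And>x. x \<in> space E \<Longrightarrow> f x \<le> c"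
  shows "(\<integral>x. f x \<partial>\<mu>) \<le> c"
  using bmeas_integral_mono[OF assms(1,2) bmeas_const, of c] assms
  by (simp only: prob_algebra_integral_const)

lemma bmeas_integral_abs_le:
  assumes "\<mu> \<in> space (prob_algebra E)" "f \<in> bmeas E" "\<And>x. x \<in> space E \<Longrightarrow> \<bar>f x\<bar> \<le> c"
  shows "\<bar>\<integral>x. f x \<partial>\<mu>\<bar> \<le> c"
  using bmeas_integral_le[OF assms(1,2), of c] bmeas_integral_ge[OF assms(1,2), of "- c"] assms(3)
  by (force simp: abs_le_iff)

lemma bmeas_integral_diff:
  assumes "\<mu> \<in> space (prob_algebra E)" "f \<in> bmeas E" "g \<in> bmeas E"
  shows "(\<integral>x. f x - g x \<partial>\<mu>) = (\<integral>x. f x \<partial>\<mu>) - (\<integral>x. g x \<partial>\<mu>)"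
  using assms by (intro Bochner_Integration.integral_diff bmeas_integrable)

lemma integral_return_bmeas:
  "x \<in> space E \<Longrightarrow> f \<in> bmeas E \<Longrightarrow> (\<integral>y. f y \<partial>return E x) = f x"
  by (simp add: integral_return bmeas_measurable)

lemma return_in_prob_algebra: "x \<in> space E \<Longrightarrow> return E x \<in> space (prob_algebra E)"
  by (simp add: space_prob_algebra prob_space_return)

lemma kernel_in_prob_algebra:
  "L \<in> E \<rightarrow>\<^sub>M prob_algebra F \<Longrightarrow> x \<in> space E \<Longrightarrow> L x \<in> space (prob_algebra F)"
  by (rule measurable_space)

lemma kernel_op_abs_le:
  assumes "L \<in> E \<rightarrow>\<^sub>M prob_algebra E" "f \<in> bmeas E" "\<And>x. x \<in> space E \<Longrightarrow> \<bar>f x\<bar> \<le> c"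
    "x \<in> space E"
  shows "\<bar>kernel_op L f x\<bar> \<le> c"
  unfolding kernel_op_def
  using assms by (intro bmeas_integral_abs_le kernel_in_prob_algebra)

lemma bmeas_kernel_op:
  assumes "L \<in> E \<rightarrow>\<^sub>M prob_algebra E" "f \<in> bmeas E"
  shows "kernel_op L f \<in> bmeas E"
proof -
  obtain B where B: "B > 0" "\<And>x. x \<in> space E \<Longrightarrow> \<bar>f x\<bar> \<le> B"
    using bmeas_bound[OF assms(2)] by blast
  show ?thesis
  proof (rule bmeasI)
    show "kernel_op L f \<in> borel_measurable E"
      unfolding kernel_op_def[abs_def]
      using assms by (intro measurable_compose[OF measurable_prob_algebraD
            integral_measurable_subprob_algebra]) (auto simp: bmeas_measurable)
    show "\<bar>kernel_op L f x\<bar> \<le> B" if "x \<in> space E" for x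
      using kernel_op_abs_le[OF assms(1,2) B(2) that] .
  qed
qed

text \<open>Source and target may differ because \<open>chain_expectation\<close> applies this to
  the kernel that extends a path of length \<open>n\<close> to one of length \<open>Suc n\<close>, a
  map between two product spaces.\<close>

lemma integral_bind_bmeas:
  assumes "\<mu> \<in> space (prob_algebra E)" "L \<in> E \<rightarrow>\<^sub>M prob_algebra F" "f \<in> bmeas F"
  shows "(\<integral>x. f x \<partial>(\<mu> \<bind> L)) = (\<integral>x. \<integral>y. f y \<partial>L x \<partial>\<mu>)"
proof -
  interpret prob_space \<mu> using assms prob_algebraD by auto
  obtain B where B: "B > 0" "\<And>x. x \<in> space F \<Longrightarrow> \<bar>f x\<bar> \<le> B"
    using bmeas_bound[OF assms(3)] by blast
  have L: "L \<in> \<mu> \<rightarrow>\<^sub>M prob_algebra F"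
    using assms by (simp add: prob_algebraD)
  have Lx: "L x \<in> space (prob_algebra F)" if "x \<in> space \<mu>" for x
    using L that by (rule kernel_in_prob_algebra)
  show ?thesis
  proof (rule integral_bind[where K=F and B=B and B'=1])
    show "f \<in> borel_measurable F"
      using assms by (simp add: bmeas_measurable)
    show "finite_measure \<mu>" by unfold_locales
    show "L \<in> \<mu> \<rightarrow>\<^sub>M subprob_algebra F"
      using L by (rule measurable_prob_algebraD)
    show "\<bar>f x\<bar> \<le> B" if "x \<in> space F" for x
      using B that by simp
    show "AE x in \<mu>. emeasure (L x) (space (L x)) \<le> ennreal 1"
      by (intro AE_I2) (auto simp: prob_space.emeasure_space_1[OF prob_algebraD(1)[OF Lx]])
  qed
qed

lemma bind_in_prob_algebra:
  assumes "\<mu> \<in> space (prob_algebra E)" "L \<in> E \<rightarrow>\<^sub>M prob_algebra F"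
  shows "\<mu> \<bind> L \<in> space (prob_algebra F)"
  using prob_space_bind'[OF assms] sets_bind'[OF assms] by (simp add: space_prob_algebra)

lemma prob_algebra_eqI:
  assumes "\<mu> \<in> space (prob_algebra E)" "\<nu> \<in> space (prob_algebra E)"
    "\<And>A. A \<in> sets E \<Longrightarrow> measure \<mu> A = measure \<nu> A"
  shows "\<mu> = \<nu>"
proof (rule measure_eqI)
  interpret \<mu>: prob_space \<mu> using assms prob_algebraD by auto
  interpret \<nu>: prob_space \<nu> using assms prob_algebraD by auto
  show "emeasure \<mu> A = emeasure \<nu> A" if "A \<in> sets \<mu>" for A
    using that assms by (simp add: \<mu>.emeasure_eq_measure \<nu>.emeasure_eq_measure prob_algebraD)
qed (use assms in \<open>simp add: prob_algebraD\<close>)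

lemma integral_indicator_prob_algebra:
  assumes "\<mu> \<in> space (prob_algebra E)" "A \<in> sets E"
  shows "(\<integral>x. indicator A x \<partial>\<mu>) = measure \<mu> A"
  using assms sets.sets_into_space[OF assms(2)]
  by (simp add: prob_algebraD Int_absorb2)

section \<open>The Feynman-Kac semigroup\<close>

text \<open>In the final theorem \<open>g\<^sub>0\<close> is the infimum of \<open>G\<close>,
  positive because the ratio of supremum to infimum is finite, and \<open>g\<^sub>1\<close> is any
  upper bound of \<open>G\<close>.\<close>

locale feynman_kac =
  fixes E :: "'a measure" and M :: "'a \<Rightarrow> 'a measure" and G :: "'a \<Rightarrow> real" and g\<^sub>0 g\<^sub>1 :: real
  assumes M_kernel: "M \<in> E \<rightarrow>\<^sub>M prob_algebra E"
    and G_measurable: "G \<in> borel_measurable E"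
    and g\<^sub>0_pos: "0 < g\<^sub>0"
    and G_bounds: "\<And>x. x \<in> space E \<Longrightarrow> g\<^sub>0 \<le> G x \<and> G x \<le> g\<^sub>1"
begin

definition Q :: "nat \<Rightarrow> ('a \<Rightarrow> real) \<Rightarrow> 'a \<Rightarrow> real" where
  "Q n = ((\<lambda>f x. G x * kernel_op M f x) ^^ n)"

lemma Q_0 [simp]: "Q 0 f = f"
  by (simp add: Q_def)

lemma Q_Suc: "Q (Suc n) f = (\<lambda>x. G x * kernel_op M (Q n f) x)"
  by (simp add: Q_def)

text \<open>\<open>Q_Suc\<close> peels off the first step of the chain; this form peels off the last
  one, as the induction on the path length requires.\<close>

lemma Q_Suc_right: "Q (Suc n) f = Q n (\<lambda>x. G x * kernel_op M f x)"
  by (simp add: Q_def funpow_Suc_right del: funpow.simps)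

lemma G_pos: "x \<in> space E \<Longrightarrow> 0 < G x"
  using G_bounds[of x] g\<^sub>0_pos by linarith

lemma bmeas_G: "G \<in> bmeas E"
proof (rule bmeasI)
  show "\<bar>G x\<bar> \<le> g\<^sub>1" if "x \<in> space E" for x
    using G_bounds[OF that] G_pos[OF that] by simp
qed (rule G_measurable)

lemma bmeas_Q: "f \<in> bmeas E \<Longrightarrow> Q n f \<in> bmeas E"
  by (induction n) (auto simp: Q_Suc intro!: bmeas_mult bmeas_G bmeas_kernel_op M_kernel)

lemma kernel_op_M_1: "x \<in> space E \<Longrightarrow> kernel_op M (\<lambda>_. 1) x = 1"
  unfolding kernel_op_def
  by (rule prob_algebra_integral_const[OF kernel_in_prob_algebra[OF M_kernel]])

lemma Q_cong:
  assumes "\<And>x. x \<in> space E \<Longrightarrow> f x = g x" "x \<in> space E"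
  shows "Q n f x = Q n g x"
  using assms(2)
proof (induction n arbitrary: x)
  case (Suc n)
  have "kernel_op M (Q n f) x = kernel_op M (Q n g) x"
    unfolding kernel_op_def
    by (rule bmeas_integral_cong[OF kernel_in_prob_algebra[OF M_kernel Suc.prems]]) (rule Suc.IH)
  then show ?case by (simp add: Q_Suc)
qed (use assms in auto)

lemma Q_divide: "Q n (\<lambda>x. f x / c) x = Q n f x / c"
  by (induction n arbitrary: x) (simp_all add: Q_Suc kernel_op_def)

text \<open>A constant lower bound survives integration, so \<open>\<mu>(q\<^sub>n)\<close> is
  positive as well as \<open>q\<^sub>n\<close>, and the later quotients are meaningful.\<close>

lemma Q_1_ge: "x \<in> space E \<Longrightarrow> g\<^sub>0 ^ n \<le> Q n (\<lambda>_. 1) x"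
proof (induction n arbitrary: x)
  case (Suc n)
  have "g\<^sub>0 ^ n \<le> kernel_op M (Q n (\<lambda>_. 1)) x"
    unfolding kernel_op_def using Suc
    by (intro bmeas_integral_ge[where E=E] kernel_in_prob_algebra[OF M_kernel] bmeas_Q) auto
  then have "g\<^sub>0 * g\<^sub>0 ^ n \<le> G x * kernel_op M (Q n (\<lambda>_. 1)) x"
    using G_bounds[OF Suc.prems] g\<^sub>0_pos by (intro mult_mono) auto
  then show ?case by (simp add: Q_Suc)
qed simp

lemma Q_1_pos: "x \<in> space E \<Longrightarrow> 0 < Q n (\<lambda>_. 1) x"
  using Q_1_ge[of x n] zero_less_power[OF g\<^sub>0_pos, of n] by linarith

lemma Q_nonneg:
  assumes "\<And>x. x \<in> space E \<Longrightarrow> 0 \<le> f x" "f \<in> bmeas E" "x \<in> space E"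
  shows "0 \<le> Q n f x"
  using assms(3)
proof (induction n arbitrary: x)
  case (Suc n)
  then show ?case
    using G_pos[of x] unfolding Q_Suc kernel_op_def
    by (intro mult_nonneg_nonneg bmeas_integral_ge[where E=E] kernel_in_prob_algebra[OF M_kernel]
          bmeas_Q assms(2)) auto
qed (use assms in auto)

lemma integral_Q_1_pos:
  assumes "\<mu> \<in> space (prob_algebra E)"
  shows "0 < (\<integral>x. Q n (\<lambda>_. 1) x \<partial>\<mu>)"
proof -
  have "g\<^sub>0 ^ n \<le> (\<integral>x. Q n (\<lambda>_. 1) x \<partial>\<mu>)"
    using assms by (intro bmeas_integral_ge[where E=E] bmeas_Q Q_1_ge) auto
  then show ?thesis
    using zero_less_power[OF g\<^sub>0_pos, of n] by linarith
qed

text \<open>The law on infinite paths is projected to the first \<open>n + 1\<close> coordinates,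
  where it is a finite composition of kernels. Integrating out the last coordinate turns
  \<open>f\<close> at time \<open>n + 1\<close>, together with the weight \<open>G\<close> at time
  \<open>n\<close>, into \<open>G \<cdot> M f\<close> at time \<open>n\<close>, and the path becomes
  shorter by one.\<close>

lemma chain_expectation:
  assumes \<mu>: "\<mu> \<in> space (prob_algebra E)" and f: "f \<in> bmeas E"
  shows "(\<integral>\<omega>. f (\<omega> n) * (\<Prod>p<n. G (\<omega> p)) \<partial>chain_law E M \<mu>) = (\<integral>x. Q n f x \<partial>\<mu>)"
proof -
  interpret IT: Ionescu_Tulcea "chain_step M \<mu>" "\<lambda>_. E"
    by (rule Ionescu_Tulcea_chain_step[OF M_kernel \<mu>])
  \<comment> \<open>The empty path, undefined everywhere, is the only point of the product over the
    empty index set; the composition \<open>IT.C 0 n\<close> starts from it.\<close>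
  define u :: "nat \<Rightarrow> 'a" where "u = (\<lambda>_. undefined)"
  have u: "u \<in> space (PiM {0..<0::nat} (\<lambda>_. E))"
    by (simp add: u_def space_PiM)
  define F where "F = (\<lambda>(n::nat) (f::'a \<Rightarrow> real) \<omega>. f (\<omega> n) * (\<Prod>p<n. G (\<omega> p)))"
  have component: "(\<lambda>\<omega>. \<omega> p) \<in> PiM {0..<m} (\<lambda>_. E) \<rightarrow>\<^sub>M E" if "p < m" for p m :: nat
    by (rule measurable_component_singleton) (use that in simp)
  have F: "F n f \<in> bmeas (PiM {0..<Suc n} (\<lambda>_. E))" if f: "f \<in> bmeas E" for n f
  proof -
    obtain B where B: "B > 0" "\<And>x. x \<in> space E \<Longrightarrow> \<bar>f x\<bar> \<le> B"
      using bmeas_bound[OF f] by blast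
    show ?thesis
    proof (rule bmeasI)
      show "F n f \<in> borel_measurable (PiM {0..<Suc n} (\<lambda>_. E))"
        unfolding F_def
        by (intro borel_measurable_times borel_measurable_prod
              measurable_compose[OF component bmeas_measurable[OF f]]
              measurable_compose[OF component G_measurable]) auto
      show "\<bar>F n f \<omega>\<bar> \<le> B * (\<Prod>p<n. g\<^sub>1)" if "\<omega> \<in> space (PiM {0..<Suc n} (\<lambda>_. E))" for \<omega>
      proof -
        have \<omega>: "\<omega> p \<in> space E" if "p < Suc n" for p
          using measurable_space[OF component[OF that] \<open>\<omega> \<in> _\<close>] .
        have "\<bar>f (\<omega> n)\<bar> \<le> B" using B \<omega> by simp
        moreover have "\<bar>\<Prod>p<n. G (\<omega> p)\<bar> \<le> (\<Prod>p<n. g\<^sub>1)"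
          unfolding abs_prod using G_bounds[OF \<omega>] G_pos[OF \<omega>]
          by (intro prod_mono) (auto simp: less_Suc_eq abs_of_pos intro: less_imp_le)
        ultimately show ?thesis
          using B by (auto simp: F_def abs_mult intro!: mult_mono)
      qed
    qed
  qed
  have C_prob: "IT.C 0 n u \<in> space (prob_algebra (PiM {0..<n} (\<lambda>_. E)))" for n
    using IT.prob_space_C[OF u, of n] IT.sets_C[OF u, of n] by (simp add: space_prob_algebra)
  have eP: "IT.eP n \<in> PiM {0..<n} (\<lambda>_. E) \<rightarrow>\<^sub>M prob_algebra (PiM {0..<Suc n} (\<lambda>_. E))" for n
    by (intro measurable_prob_algebraI IT.prob_space_eP IT.measurable_eP)
  \<comment> \<open>The last kernel \<open>IT.eP n\<close> appends a coordinate with law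
    \<open>chain_step M \<mu> n \<omega>\<close>. The weight sees earlier coordinates only, so it is
    constant under the inner integral.\<close>
  have step: "(\<integral>\<omega>. F n f \<omega> \<partial>IT.C 0 (Suc n) u) =
      (\<integral>\<omega>. (\<integral>x. f x * (\<Prod>p<n. G (\<omega> p)) \<partial>chain_step M \<mu> n \<omega>) \<partial>IT.C 0 n u)"
    if f: "f \<in> bmeas E" for n f
  proof -
    have "(\<integral>\<omega>. F n f \<omega> \<partial>IT.C 0 (Suc n) u) = (\<integral>\<omega>. (\<integral>y. F n f y \<partial>IT.eP n \<omega>) \<partial>IT.C 0 n u)"
      using integral_bind_bmeas[OF C_prob eP F[OF f]] by simp
    also have "\<dots> = (\<integral>\<omega>. (\<integral>x. f x * (\<Prod>p<n. G (\<omega> p)) \<partial>chain_step M \<mu> n \<omega>) \<partial>IT.C 0 n u)"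
    proof (rule bmeas_integral_cong[OF C_prob])
      fix \<omega> assume \<omega>: "\<omega> \<in> space (PiM {0..<n} (\<lambda>_. E))"
      have "fun_upd \<omega> n \<in> chain_step M \<mu> n \<omega> \<rightarrow>\<^sub>M PiM {0..<Suc n} (\<lambda>_. E)"
        using \<omega> by (intro measurable_fun_upd[where J="{0..<n}"])
          (auto simp: measurable_cong_sets[OF IT.sets_P[OF \<omega>]])
      then have "(\<integral>y. F n f y \<partial>IT.eP n \<omega>) = (\<integral>x. F n f (fun_upd \<omega> n x) \<partial>chain_step M \<mu> n \<omega>)"
        unfolding IT.eP_def by (intro integral_distr bmeas_measurable[OF F[OF f]])
      also have "(\<lambda>x. F n f (fun_upd \<omega> n x)) = (\<lambda>x. f x * (\<Prod>p<n. G (\<omega> p)))"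
        by (auto simp: F_def intro!: ext prod.cong arg_cong2[where f="(*)"])
      finally show "(\<integral>y. F n f y \<partial>IT.eP n \<omega>) =
        (\<integral>x. f x * (\<Prod>p<n. G (\<omega> p)) \<partial>chain_step M \<mu> n \<omega>)" .
    qed
    finally show ?thesis .
  qed
  have main: "(\<integral>\<omega>. F n f \<omega> \<partial>IT.C 0 (Suc n) u) = (\<integral>x. Q n f x \<partial>\<mu>)" if f: "f \<in> bmeas E" for n f
    using f
  proof (induction n arbitrary: f)
    case 0
    have "chain_step M \<mu> 0 \<omega> = \<mu>" for \<omega>
      by (simp add: chain_step_def)
    with step[OF 0, of 0] show ?case
      by (simp only: prob_algebra_integral_const[OF C_prob] lessThan_0 prod.empty mult_1_right Q_0)
  next
    case (Suc n)
    have "(\<integral>\<omega>. F (Suc n) f \<omega> \<partial>IT.C 0 (Suc (Suc n)) u) =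
        (\<integral>\<omega>. F n (\<lambda>x. G x * kernel_op M f x) \<omega> \<partial>IT.C 0 (Suc n) u)"
      unfolding step[OF Suc.prems]
    proof (rule bmeas_integral_cong[OF C_prob])
      fix \<omega> assume "\<omega> \<in> space (PiM {0..<Suc n} (\<lambda>_. E))"
      show "(\<integral>x. f x * (\<Prod>p<Suc n. G (\<omega> p)) \<partial>chain_step M \<mu> (Suc n) \<omega>) =
         F n (\<lambda>x. G x * kernel_op M f x) \<omega>"
        by (simp add: chain_step_def F_def kernel_op_def ac_simps)
    qed
    also have "\<dots> = (\<integral>x. Q n (\<lambda>x. G x * kernel_op M f x) x \<partial>\<mu>)"
      using Suc.prems by (intro Suc.IH bmeas_mult bmeas_G bmeas_kernel_op M_kernel)
    finally show ?case by (simp add: Q_Suc_right)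
  qed
  \<comment> \<open>On a full initial segment the embedding in the definition of the marginals is
    trivial. This connects the finite composition with the projective limit behind
    \<open>chain_law\<close>.\<close>
  have "IT.CI {0..<Suc n} = IT.C 0 (Suc n) u"
  proof (rule measure_eqI)
    show "sets (IT.CI {0..<Suc n}) = sets (IT.C 0 (Suc n) u)"
      using IT.sets_C[OF u, of "Suc n"] by (simp add: IT.CI_def)
    show "emeasure (IT.CI {0..<Suc n}) A = emeasure (IT.C 0 (Suc n) u) A"
      if "A \<in> sets (IT.CI {0..<Suc n})" for A
      using that sets.sets_into_space[of A "PiM {0..<Suc n} (\<lambda>_. E)"]
      by (subst IT.emeasure_CI[of _ "Suc n"])
         (auto simp: IT.CI_def u_def prod_emb_def space_PiM PiE_restrict intro!: arg_cong2[where f=emeasure])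
  qed
  then have C: "IT.C 0 (Suc n) u = distr (chain_law E M \<mu>) (PiM {0..<Suc n} (\<lambda>_. E)) (\<lambda>\<omega>. restrict \<omega> {0..<Suc n})"
    using IT.distr_lim[of "{0..<Suc n}"] by (simp add: chain_law_def)
  have "(\<integral>\<omega>. F n f \<omega> \<partial>IT.C 0 (Suc n) u) = (\<integral>\<omega>. F n f (restrict \<omega> {0..<Suc n}) \<partial>chain_law E M \<mu>)"
    unfolding C
    by (intro integral_distr bmeas_measurable[OF F[OF f]])
       (auto simp: chain_law_def measurable_cong_sets[OF IT.PF.sets_lim refl] intro!: measurable_restrict)
  also have "(\<lambda>\<omega>. F n f (restrict \<omega> {0..<Suc n})) = F n f"
    by (auto simp: F_def intro!: ext)
  finally show ?thesis
    using main[OF f] by (simp add: F_def)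
qed

section \<open>The map \<open>fk_Phi\<close> and its iterates\<close>

lemma integral_G_pos: "\<mu> \<in> space (prob_algebra E) \<Longrightarrow> 0 < (\<integral>x. G x \<partial>\<mu>)"
  using bmeas_integral_ge[OF _ bmeas_G, of \<mu> g\<^sub>0] G_bounds g\<^sub>0_pos by force

lemma boltzmann_gibbs_in_prob_algebra:
  assumes \<mu>: "\<mu> \<in> space (prob_algebra E)"
  shows "boltzmann_gibbs G \<mu> \<in> space (prob_algebra E)"
proof -
  have G: "G \<in> borel_measurable \<mu>"
    using \<mu> G_measurable by (simp add: prob_algebraD)
  have nn: "0 \<le> G x / (\<integral>y. G y \<partial>\<mu>)" if "x \<in> space \<mu>" for x
    using G_pos[of x] integral_G_pos[OF \<mu>] that \<mu> by (auto simp: prob_algebraD)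
  have "emeasure (boltzmann_gibbs G \<mu>) (space (boltzmann_gibbs G \<mu>)) =
      (\<integral>\<^sup>+x. ennreal (G x / (\<integral>y. G y \<partial>\<mu>)) \<partial>\<mu>)"
    using G by (simp add: boltzmann_gibbs_def emeasure_density cong: nn_integral_cong)
  also have "\<dots> = ennreal (\<integral>x. G x / (\<integral>y. G y \<partial>\<mu>) \<partial>\<mu>)"
    using nn by (intro nn_integral_eq_integral AE_I2 bmeas_integrable[OF \<mu>] bmeas_divide_const bmeas_G)
  also have "\<dots> = 1"
    using integral_G_pos[OF \<mu>] by simp
  finally show ?thesis
    using \<mu> by (auto simp: space_prob_algebra boltzmann_gibbs_def intro!: prob_spaceI)
qed

lemma integral_boltzmann_gibbs:
  assumes \<mu>: "\<mu> \<in> space (prob_algebra E)" and f: "f \<in> bmeas E"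
  shows "(\<integral>x. f x \<partial>boltzmann_gibbs G \<mu>) = (\<integral>x. G x * f x \<partial>\<mu>) / (\<integral>x. G x \<partial>\<mu>)"
proof -
  have "(\<integral>x. f x \<partial>boltzmann_gibbs G \<mu>) = (\<integral>x. (G x / (\<integral>y. G y \<partial>\<mu>)) *\<^sub>R f x \<partial>\<mu>)"
    unfolding boltzmann_gibbs_def
    using \<mu> f G_measurable G_pos integral_G_pos[OF \<mu>]
    by (intro integral_density) (auto simp: prob_algebraD bmeas_measurable less_imp_le)
  then show ?thesis by simp
qed

lemma fk_Phi_in_prob_algebra:
  "\<mu> \<in> space (prob_algebra E) \<Longrightarrow> fk_Phi M G \<mu> \<in> space (prob_algebra E)"
  unfolding fk_Phi_def
  by (intro bind_in_prob_algebra[OF boltzmann_gibbs_in_prob_algebra M_kernel])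

lemma integral_fk_Phi:
  assumes \<mu>: "\<mu> \<in> space (prob_algebra E)" and f: "f \<in> bmeas E"
  shows "(\<integral>x. f x \<partial>fk_Phi M G \<mu>) = (\<integral>x. G x * kernel_op M f x \<partial>\<mu>) / (\<integral>x. G x \<partial>\<mu>)"
  unfolding fk_Phi_def integral_bind_bmeas[OF boltzmann_gibbs_in_prob_algebra[OF \<mu>] M_kernel f]
  using integral_boltzmann_gibbs[OF \<mu> bmeas_kernel_op[OF M_kernel f]]
  by (simp add: kernel_op_def)

lemma funpow_fk_Phi_in_prob_algebra:
  "\<mu> \<in> space (prob_algebra E) \<Longrightarrow> (fk_Phi M G ^^ n) \<mu> \<in> space (prob_algebra E)"
  by (induction n) (auto intro: fk_Phi_in_prob_algebra)

text \<open>The normalisations telescope: one more application of \<open>fk_Phi\<close> divides by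
  \<open>\<Phi>\<^sup>n(\<mu>)(G) = \<mu>(q\<^sub>n\<^sub>+\<^sub>1) / \<mu>(q\<^sub>n)\<close>,
  which cancels the old denominator \<open>\<mu>(q\<^sub>n)\<close>.\<close>

lemma integral_funpow_fk_Phi:
  assumes \<mu>: "\<mu> \<in> space (prob_algebra E)" and f: "f \<in> bmeas E"
  shows "(\<integral>x. f x \<partial>(fk_Phi M G ^^ n) \<mu>) = (\<integral>x. Q n f x \<partial>\<mu>) / (\<integral>x. Q n (\<lambda>_. 1) x \<partial>\<mu>)"
  using f
proof (induction n arbitrary: f)
  case 0
  show ?case using prob_algebra_integral_const[OF \<mu>, of 1] by simp
next
  case (Suc n)
  define \<nu> where "\<nu> = (fk_Phi M G ^^ n) \<mu>"
  have \<nu>: "\<nu> \<in> space (prob_algebra E)"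
    unfolding \<nu>_def by (rule funpow_fk_Phi_in_prob_algebra[OF \<mu>])
  have Q: "(\<lambda>x. G x * kernel_op M f x) \<in> bmeas E" if "f \<in> bmeas E" for f
    using that by (intro bmeas_mult bmeas_G bmeas_kernel_op M_kernel)
  have IH: "(\<integral>x. G x * kernel_op M f x \<partial>\<nu>) = (\<integral>x. Q (Suc n) f x \<partial>\<mu>) / (\<integral>x. Q n (\<lambda>_. 1) x \<partial>\<mu>)"
    if "f \<in> bmeas E" for f
    using Suc.IH[OF Q[OF that]] by (simp add: \<nu>_def Q_Suc_right)
  \<comment> \<open>Writing \<open>G\<close> as \<open>G \<cdot> M 1\<close> makes the normalising
    constant another instance of the induction hypothesis.\<close>
  have "(\<integral>x. G x \<partial>\<nu>) = (\<integral>x. G x * kernel_op M (\<lambda>_. 1) x \<partial>\<nu>)"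
    by (rule bmeas_integral_cong[OF \<nu>]) (simp add: kernel_op_M_1)
  also have "\<dots> = (\<integral>x. Q (Suc n) (\<lambda>_. 1) x \<partial>\<mu>) / (\<integral>x. Q n (\<lambda>_. 1) x \<partial>\<mu>)"
    by (rule IH) simp
  finally have "(\<integral>x. f x \<partial>fk_Phi M G \<nu>) = (\<integral>x. Q (Suc n) f x \<partial>\<mu>) / (\<integral>x. Q (Suc n) (\<lambda>_. 1) x \<partial>\<mu>)"
    using integral_fk_Phi[OF \<nu> Suc.prems] IH[OF Suc.prems] integral_Q_1_pos[OF \<mu>, of n] by simp
  then show ?case by (simp add: \<nu>_def)
qed

section \<open>Identification of the path-space definitions\<close>

lemma fk_Q_eq:
  assumes x: "x \<in> space E" and f: "f \<in> bmeas E"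
  shows "fk_Q E M G p n f x = Q (n - p) f x"
proof -
  have "(\<Prod>q=p..<n. G (\<omega> (q - p))) = (\<Prod>q<n - p. G (\<omega> q))" for \<omega>
    by (rule prod.reindex_bij_witness[where i="\<lambda>q. q + p" and j="\<lambda>q. q - p"]) auto
  then show ?thesis
    using chain_expectation[OF return_in_prob_algebra[OF x] f, of "n - p"]
    by (simp add: fk_Q_def integral_return_bmeas[OF x bmeas_Q[OF f]])
qed

text \<open>On each measurable \<open>A\<close> both sides have mass
  \<open>\<mu>(Q\<^sup>n 1\<^sub>A) / \<mu>(q\<^sub>n)\<close>. From here on the path law no longer
  occurs: only \<open>Q\<close> and the iterates of \<open>fk_Phi\<close> are used.\<close>

lemma fk_eta_eq:
  assumes \<mu>: "\<mu> \<in> space (prob_algebra E)"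
  shows "fk_eta E M G \<mu> n = (fk_Phi M G ^^ n) \<mu>"
proof -
  interpret IT: Ionescu_Tulcea "chain_step M \<mu>" "\<lambda>_. E"
    by (rule Ionescu_Tulcea_chain_step[OF M_kernel \<mu>])
  have sets_C: "sets (chain_law E M \<mu>) = sets (PiM UNIV (\<lambda>_. E))"
    by (simp add: chain_law_def)
  then have space_C: "space (chain_law E M \<mu>) = space (PiM UNIV (\<lambda>_. E))"
    by (rule sets_eq_imp_space_eq)
  \<comment> \<open>The total mass is read off from the marginal on the empty index set, which is a
    probability measure.\<close>
  interpret C: prob_space "chain_law E M \<mu>"
  proof (rule prob_space_distrD)
    show "(\<lambda>\<omega>. restrict \<omega> {}) \<in> chain_law E M \<mu> \<rightarrow>\<^sub>M PiM {} (\<lambda>_. E)"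
      by (simp add: measurable_cong_sets[OF sets_C refl] measurable_restrict)
    show "prob_space (distr (chain_law E M \<mu>) (PiM {} (\<lambda>_. E)) (\<lambda>\<omega>. restrict \<omega> {}))"
      using IT.distr_lim[of "{}"] IT.PF.prob_space_P[of "{}"] by (simp add: chain_law_def)
  qed
  have X: "(\<lambda>\<omega>. \<omega> p) \<in> chain_law E M \<mu> \<rightarrow>\<^sub>M E" for p
    using measurable_component_singleton[of p UNIV "\<lambda>_. E"] by (simp add: measurable_cong_sets[OF sets_C])
  define w where "w \<omega> = (\<Prod>p<n. G (\<omega> p))" for \<omega> :: "nat \<Rightarrow> 'a"
  have X_space: "\<omega> p \<in> space E" if "\<omega> \<in> space (chain_law E M \<mu>)" for \<omega> p
    using measurable_space[OF X that] .
  have w: "w \<in> borel_measurable (chain_law E M \<mu>)"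
    unfolding w_def[abs_def]
    by (intro borel_measurable_prod measurable_compose[OF X G_measurable])
  have w_nonneg: "0 \<le> w \<omega>" and w_le: "w \<omega> \<le> (\<Prod>p<n. g\<^sub>1)" if "\<omega> \<in> space (chain_law E M \<mu>)" for \<omega>
    using G_pos[OF X_space[OF that]] G_bounds[OF X_space[OF that]]
    unfolding w_def by (intro prod_nonneg prod_mono; auto intro: less_imp_le)+
  define \<gamma> where "\<gamma> = fk_gamma E M G \<mu> n"
  have sets_\<gamma>: "sets \<gamma> = sets E"
    by (simp add: \<gamma>_def fk_gamma_def)
  have \<gamma>: "emeasure \<gamma> A = ennreal (\<integral>x. Q n (indicator A) x \<partial>\<mu>)" if A: "A \<in> sets E" for A
  proof -
    have *: "(\<lambda>\<omega>. w \<omega> * indicator A (\<omega> n)) \<in> borel_measurable (chain_law E M \<mu>)"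
      using A by (intro borel_measurable_times w measurable_compose[OF X borel_measurable_indicator])
    have "(\<lambda>\<omega>. \<omega> n) -` A \<inter> space (chain_law E M \<mu>) \<in> sets (chain_law E M \<mu>)"
      using X A by (rule measurable_sets)
    then have "emeasure \<gamma> A = (\<integral>\<^sup>+\<omega>. ennreal (w \<omega>) * indicator ((\<lambda>\<omega>. \<omega> n) -` A \<inter> space (chain_law E M \<mu>)) \<omega> \<partial>chain_law E M \<mu>)"
      unfolding \<gamma>_def fk_gamma_def w_def[symmetric] using A w X
      by (simp add: emeasure_distr emeasure_density)
    also have "\<dots> = (\<integral>\<^sup>+\<omega>. ennreal (w \<omega> * indicator A (\<omega> n)) \<partial>chain_law E M \<mu>)"
      by (intro nn_integral_cong) (auto split: split_indicator)
    also have "\<dots> = ennreal (\<integral>\<omega>. w \<omega> * indicator A (\<omega> n) \<partial>chain_law E M \<mu>)"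
    proof (intro nn_integral_eq_integral AE_I2)
      show "integrable (chain_law E M \<mu>) (\<lambda>\<omega>. w \<omega> * indicator A (\<omega> n))"
        using w_nonneg w_le *
        by (intro C.integrable_const_bound[where B="\<Prod>p<n. g\<^sub>1"] AE_I2)
           (auto simp: abs_mult split: split_indicator intro: order_trans[OF w_nonneg w_le[simplified]])
      show "0 \<le> w \<omega> * indicator A (\<omega> n)" if "\<omega> \<in> space (chain_law E M \<mu>)" for \<omega>
        using w_nonneg[OF that] by (simp split: split_indicator)
    qed
    also have "(\<integral>\<omega>. w \<omega> * indicator A (\<omega> n) \<partial>chain_law E M \<mu>) = (\<integral>x. Q n (indicator A) x \<partial>\<mu>)"
      using chain_expectation[OF \<mu> bmeas_indicator[OF A], of n] by (simp add: w_def mult.commute)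
    finally show ?thesis .
  qed
  have "emeasure \<gamma> (space E) = ennreal (\<integral>x. Q n (indicator (space E)) x \<partial>\<mu>)"
    by (rule \<gamma>) simp
  also have "(\<integral>x. Q n (indicator (space E)) x \<partial>\<mu>) = (\<integral>x. Q n (\<lambda>_. 1) x \<partial>\<mu>)"
    by (intro bmeas_integral_cong[OF \<mu>] Q_cong) auto
  finally have \<gamma>_space: "emeasure \<gamma> (space E) = ennreal (\<integral>x. Q n (\<lambda>_. 1) x \<partial>\<mu>)" .
  show ?thesis
  proof (rule measure_eqI)
    let ?\<nu> = "(fk_Phi M G ^^ n) \<mu>"
    have \<nu>: "?\<nu> \<in> space (prob_algebra E)"
      by (rule funpow_fk_Phi_in_prob_algebra[OF \<mu>])
    interpret \<nu>: prob_space ?\<nu> by (rule prob_algebraD[OF \<nu>])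
    show "sets (fk_eta E M G \<mu> n) = sets ?\<nu>"
      using \<nu> sets_\<gamma> by (simp add: fk_eta_def \<gamma>_def prob_algebraD)
    show "emeasure (fk_eta E M G \<mu> n) A = emeasure ?\<nu> A" if "A \<in> sets (fk_eta E M G \<mu> n)" for A
    proof -
      have A: "A \<in> sets E"
        using that sets_\<gamma> by (simp add: fk_eta_def \<gamma>_def)
      have nn: "0 \<le> (\<integral>x. Q n (indicator A) x \<partial>\<mu>)"
        by (intro bmeas_integral_ge[OF \<mu>] bmeas_Q Q_nonneg bmeas_indicator A) auto
      have "measure ?\<nu> A = (\<integral>x. Q n (indicator A) x \<partial>\<mu>) / (\<integral>x. Q n (\<lambda>_. 1) x \<partial>\<mu>)"
        using integral_funpow_fk_Phi[OF \<mu> bmeas_indicator[OF A], of n]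
          integral_indicator_prob_algebra[OF \<nu> A] by simp
      then have "emeasure ?\<nu> A = ennreal ((\<integral>x. Q n (indicator A) x \<partial>\<mu>) / (\<integral>x. Q n (\<lambda>_. 1) x \<partial>\<mu>))"
        by (simp add: \<nu>.emeasure_eq_measure)
      also have "\<dots> = 1 / emeasure \<gamma> (space E) * emeasure \<gamma> A"
        using nn integral_Q_1_pos[OF \<mu>, of n]
        by (simp add: \<gamma>_space \<gamma>[OF A] divide_ennreal[symmetric]
              mult.commute[of _ "ennreal (integral\<^sup>L \<mu> (Q n (indicator A)))"] ennreal_times_divide)
      finally show ?thesis
        by (simp add: fk_eta_def \<gamma>_def)
    qed
  qed
qed

end

section \<open>The fixed point\<close>

text \<open>The integrand is approximated by the average of the indicators of its superlevel sets
  at the heights \<open>(k + 1) / N\<close>.\<close>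

lemma integral_diff_le_measure_diff:
  assumes \<mu>: "\<mu> \<in> space (prob_algebra E)" and \<nu>: "\<nu> \<in> space (prob_algebra E)"
    and f: "f \<in> borel_measurable E" "\<And>x. x \<in> space E \<Longrightarrow> 0 \<le> f x \<and> f x \<le> 1"
    and le: "\<And>A. A \<in> sets E \<Longrightarrow> \<bar>measure \<mu> A - measure \<nu> A\<bar> \<le> \<epsilon>"
  shows "\<bar>(\<integral>x. f x \<partial>\<mu>) - (\<integral>x. f x \<partial>\<nu>)\<bar> \<le> \<epsilon>"
proof -
  \<comment> \<open>Replacing \<open>f\<close> by its step approximation costs one level width
    \<open>1 / Suc N\<close> under each of the two measures.\<close>
  have *: "\<bar>(\<integral>x. f x \<partial>\<mu>) - (\<integral>x. f x \<partial>\<nu>)\<bar> \<le> \<epsilon> + 2 * (1 / real (Suc N))" for N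
  proof -
    define n where "n = Suc N"
    define A where "A k = {x \<in> space E. real (Suc k) \<le> real n * f x}" for k
    define s where "s x = (\<Sum>k<n. indicator (A k) x) / real n" for x
    have n: "n > 0" by (simp add: n_def)
    have A: "A k \<in> sets E" for k
      using f unfolding A_def by measurable
    have s_bmeas: "s \<in> bmeas E"
      unfolding s_def
    proof (intro bmeas_divide_const bmeasI)
      show "(\<lambda>x. \<Sum>k<n. indicator (A k) x :: real) \<in> borel_measurable E"
        using A by simp
      show "\<bar>\<Sum>k<n. indicator (A k) x\<bar> \<le> real n" for x
        using sum_bounded_above[of "{..<n}" "\<lambda>k. indicator (A k) x" "1::real"]
        by (simp add: sum_nonneg)
    qed
    have f_bmeas: "f \<in> bmeas E"
      using f by (intro bmeasI[where B=1]) auto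
    have near: "\<bar>f x - s x\<bar> \<le> 1 / real n" if x: "x \<in> space E" for x
    proof -
      \<comment> \<open>Since \<open>f x \<le> 1\<close>, exactly the first
        \<open>\<lfloor>n f(x)\<rfloor>\<close> of the \<open>n\<close> superlevel sets contain
        \<open>x\<close>, so \<open>s x\<close> is \<open>f x\<close> rounded down to a multiple of
        \<open>1 / n\<close>.\<close>
      have "nat \<lfloor>real n * f x\<rfloor> \<le> n"
        using f(2)[OF x] n by (simp add: floor_le_iff nat_le_iff mult_left_le le_less_trans[OF mult_left_le])
      then have "{k \<in> {..<n}. real (Suc k) \<le> real n * f x} = {..<nat \<lfloor>real n * f x\<rfloor>}"
        by (auto simp: less_eq_nat.simps Suc_le_eq zless_nat_eq_int_zless le_floor_iff[symmetric]
            nat_less_iff[symmetric]; linarith)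
      moreover have "(\<Sum>k<n. indicator (A k) x) = real (card {k \<in> {..<n}. real (Suc k) \<le> real n * f x})"
        using x by (auto simp: A_def indicator_def of_nat_sum[symmetric] sum.If_cases Int_def)
      ultimately have "s x = real_of_int \<lfloor>real n * f x\<rfloor> / real n"
        using f(2)[OF x] by (simp add: s_def)
      moreover have "\<bar>real n * f x - real_of_int \<lfloor>real n * f x\<rfloor>\<bar> \<le> 1"
        by linarith
      moreover have "real n * \<bar>f x - s x\<bar> = \<bar>real n * f x - real n * s x\<bar>"
        by (simp add: abs_mult flip: right_diff_distrib)
      ultimately have "real n * \<bar>f x - s x\<bar> \<le> 1"
        using n by simp
      then show ?thesis using n by (simp add: field_simps)
    qed
    have I: "\<bar>(\<integral>x. f x \<partial>\<rho>) - (\<integral>x. s x \<partial>\<rho>)\<bar> \<le> 1 / real n"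
      and S: "(\<integral>x. s x \<partial>\<rho>) = (\<Sum>k<n. measure \<rho> (A k)) / real n"
      if \<rho>: "\<rho> \<in> space (prob_algebra E)" for \<rho>
    proof -
      show "\<bar>(\<integral>x. f x \<partial>\<rho>) - (\<integral>x. s x \<partial>\<rho>)\<bar> \<le> 1 / real n"
        unfolding bmeas_integral_diff[OF \<rho> f_bmeas s_bmeas, symmetric]
        by (rule bmeas_integral_abs_le[OF \<rho> bmeas_diff[OF f_bmeas s_bmeas] near])
      show "(\<integral>x. s x \<partial>\<rho>) = (\<Sum>k<n. measure \<rho> (A k)) / real n"
        unfolding s_def
        by (simp only: integral_divide_zero
            Bochner_Integration.integral_sum[OF bmeas_integrable[OF \<rho> bmeas_indicator[OF A]]]
            integral_indicator_prob_algebra[OF \<rho> A])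
    qed
    have "\<bar>(\<Sum>k<n. measure \<mu> (A k)) - (\<Sum>k<n. measure \<nu> (A k))\<bar> \<le> (\<Sum>k<n. \<epsilon>)"
      unfolding sum_subtractf[symmetric] by (intro order_trans[OF sum_abs] sum_mono le A)
    then have "\<bar>(\<integral>x. s x \<partial>\<mu>) - (\<integral>x. s x \<partial>\<nu>)\<bar> \<le> \<epsilon>"
      using n by (simp add: S[OF \<mu>] S[OF \<nu>] diff_divide_distrib[symmetric] field_simps)
    with I[OF \<mu>] I[OF \<nu>] show ?thesis
      unfolding n_def by linarith
  qed
  have "(\<lambda>N. \<epsilon> + 2 * (1 / real (Suc N))) \<longlonglongrightarrow> \<epsilon> + 2 * 0"
    by (intro tendsto_intros LIMSEQ_Suc[OF lim_1_over_n])
  with * show ?thesis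
    by (auto intro!: LIMSEQ_le_const)
qed

text \<open>Completeness in total variation. The limits of the measures of single sets exist and are
  finitely additive; the uniformity of \<open>e n\<close> in the set yields countable additivity.
  Letting the larger index tend to infinity in the Cauchy bound preserves the rate.\<close>

lemma prob_algebra_complete:
  assumes \<mu>: "\<And>n. \<mu> n \<in> space (prob_algebra E)"
    and cauchy: "\<And>A m n. A \<in> sets E \<Longrightarrow> n \<le> m \<Longrightarrow> \<bar>measure (\<mu> m) A - measure (\<mu> n) A\<bar> \<le> e n"
    and e: "e \<longlonglongrightarrow> 0"
  obtains \<nu> where "\<nu> \<in> space (prob_algebra E)"
    "\<And>A n. A \<in> sets E \<Longrightarrow> \<bar>measure (\<mu> n) A - measure \<nu> A\<bar> \<le> e n"
proof -
  define m where "m A = lim (\<lambda>n. measure (\<mu> n) A)" for A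
  interpret \<mu>: prob_space "\<mu> n" for n by (rule prob_algebraD[OF \<mu>])
  have m: "(\<lambda>n. measure (\<mu> n) A) \<longlonglongrightarrow> m A" if A: "A \<in> sets E" for A
    unfolding m_def convergent_LIMSEQ_iff[symmetric]
  proof (rule Cauchy_convergent, rule metric_CauchyI)
    fix \<epsilon> :: real assume "\<epsilon> > 0"
    then obtain N where N: "e N < \<epsilon> / 2"
      using order_tendstoD(2)[OF e, of "\<epsilon> / 2"] by (auto simp: eventually_sequentially)
    show "\<exists>N. \<forall>i\<ge>N. \<forall>j\<ge>N. dist (measure (\<mu> i) A) (measure (\<mu> j) A) < \<epsilon>"
    proof (intro exI[of _ N] allI impI)
      fix i j assume "N \<le> i" "N \<le> j"
      with cauchy[OF A, of N i] cauchy[OF A, of N j] N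
      show "dist (measure (\<mu> i) A) (measure (\<mu> j) A) < \<epsilon>"
        by (simp add: dist_real_def)
    qed
  qed
  have m_le: "\<bar>measure (\<mu> n) A - m A\<bar> \<le> e n" if A: "A \<in> sets E" for A n
  proof (rule LIMSEQ_le_const2)
    show "(\<lambda>k. \<bar>measure (\<mu> n) A - measure (\<mu> k) A\<bar>) \<longlonglongrightarrow> \<bar>measure (\<mu> n) A - m A\<bar>"
      by (intro tendsto_intros m A)
    show "\<exists>N. \<forall>k\<ge>N. \<bar>measure (\<mu> n) A - measure (\<mu> k) A\<bar> \<le> e n"
      using cauchy[OF A, of n] by (auto simp: abs_minus_commute)
  qed
  have m_nonneg: "0 \<le> m A" if "A \<in> sets E" for A
    using m[OF that] by (rule LIMSEQ_le_const) auto
  have m_add: "m (A \<union> B) = m A + m B" if "A \<in> sets E" "B \<in> sets E" "A \<inter> B = {}" for A B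
  proof (rule LIMSEQ_unique[OF m])
    show "A \<union> B \<in> sets E" using that by auto
    have "measure (\<mu> n) (A \<union> B) = measure (\<mu> n) A + measure (\<mu> n) B" for n
      using that prob_algebraD[OF \<mu>[of n]] by (intro \<mu>.finite_measure_Union) auto
    then show "(\<lambda>n. measure (\<mu> n) (A \<union> B)) \<longlonglongrightarrow> m A + m B"
      using tendsto_add[OF m[OF that(1)] m[OF that(2)]] by simp
  qed
  have m_empty: "m {} = 0"
    using m_add[of "{}" "{}"] by simp
  have m_space: "m (space E) = 1"
  proof (rule LIMSEQ_unique[OF m])
    show "(\<lambda>n. measure (\<mu> n) (space E)) \<longlonglongrightarrow> 1"
      using \<mu>.prob_space by (simp add: prob_algebraD[OF \<mu>])
  qed simp
  have "countably_additive (sets E) (\<lambda>A. ennreal (m A))"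
  proof (rule sets.empty_continuous_imp_countably_additive)
    show "positive (sets E) (\<lambda>A. ennreal (m A))"
      by (simp add: positive_def m_empty)
    show "additive (sets E) (\<lambda>A. ennreal (m A))"
      by (auto simp: additive_def m_add m_nonneg ennreal_plus)
    fix A :: "nat \<Rightarrow> 'a set"
    assume A: "range A \<subseteq> sets E" "decseq A" "(\<Inter>i. A i) = {}"
    \<comment> \<open>An index \<open>N\<close> with \<open>e N < \<epsilon> / 2\<close> is chosen
      before the sets shrink; continuity from above of the single measure \<open>\<mu> N\<close>
      supplies the other half.\<close>
    have "(\<lambda>i. m (A i)) \<longlonglongrightarrow> 0"
    proof (rule LIMSEQ_I)
      fix \<epsilon> :: real assume "\<epsilon> > 0"
      then obtain N where N: "e N < \<epsilon> / 2"
        using order_tendstoD(2)[OF e, of "\<epsilon> / 2"] by (auto simp: eventually_sequentially)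
      have "(\<lambda>i. measure (\<mu> N) (A i)) \<longlonglongrightarrow> measure (\<mu> N) (\<Inter>i. A i)"
        using A by (intro \<mu>.finite_Lim_measure_decseq) (auto simp: prob_algebraD[OF \<mu>])
      then obtain n where n: "\<forall>i\<ge>n. measure (\<mu> N) (A i) < \<epsilon> / 2"
        using order_tendstoD(2)[of "\<lambda>i. measure (\<mu> N) (A i)" 0 sequentially "\<epsilon> / 2"] \<open>\<epsilon> > 0\<close> A
        by (auto simp: eventually_sequentially)
      show "\<exists>n. \<forall>i\<ge>n. norm (m (A i) - 0) < \<epsilon>"
      proof (intro exI[of _ n] allI impI)
        fix i assume "n \<le> i"
        have "A i \<in> sets E" using A by auto
        with m_le[of "A i" N] m_nonneg[of "A i"] n \<open>n \<le> i\<close> N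
        have "m (A i) < \<epsilon> / 2 + \<epsilon> / 2" by fastforce
        then show "norm (m (A i) - 0) < \<epsilon>"
          using m_nonneg[OF \<open>A i \<in> sets E\<close>] by simp
      qed
    qed
    then show "(\<lambda>i. ennreal (m (A i))) \<longlonglongrightarrow> 0"
      using tendsto_ennrealI by fastforce
  qed simp
  moreover define \<nu> where "\<nu> = measure_of (space E) (sets E) (\<lambda>A. ennreal (m A))"
  ultimately have \<nu>: "emeasure \<nu> A = ennreal (m A)" if "A \<in> sets E" for A
    using that by (intro emeasure_measure_of[OF \<nu>_def])
      (auto simp: positive_def m_empty dest: sets.sets_into_space)
  have \<nu>_sets: "sets \<nu> = sets E" "space \<nu> = space E"
    by (auto simp: \<nu>_def)
  show ?thesis
  proof
    show "\<nu> \<in> space (prob_algebra E)"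
      using \<nu>_sets \<nu>[of "space E"] by (auto simp: space_prob_algebra m_space intro!: prob_spaceI)
    show "\<bar>measure (\<mu> n) A - measure \<nu> A\<bar> \<le> e n" if "A \<in> sets E" for A n
      using m_le[OF that] m_nonneg[OF that] by (simp add: measure_def[of \<nu>] \<nu>[OF that])
  qed
qed

section \<open>Oscillation and the Dobrushin coefficient\<close>

lemma OscI:
  assumes "f \<in> borel_measurable E"
    "\<And>x y. x \<in> space E \<Longrightarrow> y \<in> space E \<Longrightarrow> \<bar>f x - f y\<bar> \<le> 1"
  shows "f \<in> Osc E"
  using assms by (auto simp: Osc_def osc_def intro!: SUP_least)

lemma OscD:
  assumes "f \<in> Osc E" "x \<in> space E" "y \<in> space E"
  shows "\<bar>f x - f y\<bar> \<le> 1"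
proof -
  have "ereal \<bar>f x - f y\<bar> \<le> osc E f"
    unfolding osc_def by (rule SUP_upper2[OF assms(2)], rule SUP_upper[OF assms(3)])
  also have "\<dots> \<le> 1"
    using assms by (simp add: Osc_def)
  finally show ?thesis by simp
qed

lemma dobrushinD:
  assumes "dobrushin E P \<le> ereal c" "f \<in> Osc E" "x \<in> space E" "y \<in> space E"
  shows "\<bar>P f x - P f y\<bar> \<le> c"
proof -
  have "ereal \<bar>P f x - P f y\<bar> \<le> dobrushin E P"
    unfolding dobrushin_def
    by (rule SUP_upper2[OF assms(3)], rule SUP_upper2[OF assms(4)], rule SUP_upper[OF assms(2)])
  with assms(1) show ?thesis by (metis order_trans ereal_less_eq(3))
qed

lemma Osc_bmeas:
  assumes "f \<in> Osc E"
  shows "f \<in> bmeas E"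
proof (cases "space E = {}")
  case True
  then show ?thesis using assms by (auto simp: Osc_def bmeas_def)
next
  case False
  then obtain y where y: "y \<in> space E" by auto
  show ?thesis
  proof (rule bmeasI)
    show "\<bar>f x\<bar> \<le> 1 + \<bar>f y\<bar>" if "x \<in> space E" for x
      using OscD[OF assms that y] by linarith
  qed (use assms in \<open>simp add: Osc_def\<close>)
qed

text \<open>Two values in \<open>[-B, B]\<close> differ by at most \<open>2 * B\<close>; this is the
  source of the factors \<open>2 * B\<close> in the contraction estimates.\<close>

lemma bmeas_normalize_Osc:
  assumes "f \<in> bmeas E" "0 < B" "\<And>x. x \<in> space E \<Longrightarrow> \<bar>f x\<bar> \<le> B"
  shows "(\<lambda>x. f x / (2 * B)) \<in> Osc E"
proof (rule OscI)
  show "(\<lambda>x. f x / (2 * B)) \<in> borel_measurable E"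
    using bmeas_divide_const[OF assms(1)] by (rule bmeas_measurable)
  show "\<bar>f x / (2 * B) - f y / (2 * B)\<bar> \<le> 1" if "x \<in> space E" "y \<in> space E" for x y
    using assms(2) assms(3)[OF that(1)] assms(3)[OF that(2)]
    by (simp add: diff_divide_distrib[symmetric] abs_le_iff)
qed

section \<open>Exponential contraction of the flow\<close>

locale stable_feynman_kac = feynman_kac +
  fixes a lam :: real
  assumes lam_pos: "0 < lam"
    and stability: "\<And>p n. p \<le> n \<Longrightarrow>
      dobrushin E (fk_P E M G p n) \<le> ereal (a * exp (- lam * real (n - p)))"
    and E_nonempty: "space E \<noteq> {}"
begin

lemma Q_ratio_osc:
  assumes f: "f \<in> bmeas E" "\<And>x. x \<in> space E \<Longrightarrow> \<bar>f x\<bar> \<le> B" and B: "0 < B"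
    and x: "x \<in> space E" and y: "y \<in> space E"
  shows "\<bar>Q n f x / Q n (\<lambda>_. 1) x - Q n f y / Q n (\<lambda>_. 1) y\<bar> \<le> 2 * B * a * exp (- lam * real n)"
proof -
  have P: "fk_P E M G 0 n (\<lambda>x. f x / (2 * B)) z = Q n f z / Q n (\<lambda>_. 1) z / (2 * B)"
    if z: "z \<in> space E" for z
    using z f by (simp add: fk_P_def fk_Q_eq bmeas_divide_const Q_divide)
  have "\<bar>Q n f x / Q n (\<lambda>_. 1) x / (2 * B) - Q n f y / Q n (\<lambda>_. 1) y / (2 * B)\<bar> \<le> a * exp (- lam * real n)"
    using dobrushinD[OF stability[of 0 n] bmeas_normalize_Osc[OF f(1) B f(2)] x y]
    by (simp add: P x y)
  then have "\<bar>Q n f x / Q n (\<lambda>_. 1) x - Q n f y / Q n (\<lambda>_. 1) y\<bar> / (2 * B) \<le> a * exp (- lam * real n)"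
    using B by (simp add: diff_divide_distrib[symmetric] del: divide_divide_eq_left)
  then show ?thesis using B by (simp add: pos_divide_le_eq ac_simps)
qed

text \<open>At \<open>n = 0\<close> the oscillation estimate for the constant function
  \<open>1\<close> at a single point reads \<open>0 \<le> 2 * a\<close>.\<close>

lemma a_nonneg: "0 \<le> a"
proof -
  obtain x where "x \<in> space E" using E_nonempty by auto
  with Q_ratio_osc[of "\<lambda>_. 1" 1 x x 0] show ?thesis by simp
qed

text \<open>Both integrals are averages of the same ratio, under the laws with density proportional
  to \<open>q\<^sub>n\<close> with respect to \<open>\<mu>\<close> and \<open>\<nu>\<close>. Two
  averages of one function cannot be further apart than its values.\<close>

lemma Q_ratio_average_le:
  assumes \<mu>: "\<mu> \<in> space (prob_algebra E)" and \<nu>: "\<nu> \<in> space (prob_algebra E)"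
    and f: "f \<in> bmeas E"
    and osc: "\<And>x y. x \<in> space E \<Longrightarrow> y \<in> space E \<Longrightarrow>
       Q n f x / Q n (\<lambda>_. 1) x - Q n f y / Q n (\<lambda>_. 1) y \<le> d"
  shows "(\<integral>x. f x \<partial>(fk_Phi M G ^^ n) \<mu>) - (\<integral>x. f x \<partial>(fk_Phi M G ^^ n) \<nu>) \<le> d"
proof -
  define U where "U = (\<integral>x. f x \<partial>(fk_Phi M G ^^ n) \<mu>)"
  have Q1: "Q n (\<lambda>_. 1) \<in> bmeas E" by (intro bmeas_Q) simp
  \<comment> \<open>First the average over \<open>\<mu>\<close> is taken with \<open>y\<close>
    fixed; integrating the resulting bound over \<open>y\<close> under \<open>\<nu>\<close>
    finishes. Multiplying by \<open>q\<^sub>n > 0\<close> before each integration avoids changing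
    the measure.\<close>
  have "U - d \<le> Q n f y / Q n (\<lambda>_. 1) y" if y: "y \<in> space E" for y
  proof -
    let ?c = "Q n f y / Q n (\<lambda>_. 1) y + d"
    have "(\<integral>x. Q n f x \<partial>\<mu>) \<le> (\<integral>x. ?c * Q n (\<lambda>_. 1) x \<partial>\<mu>)"
    proof (rule bmeas_integral_mono[OF \<mu> bmeas_Q[OF f]])
      show "(\<lambda>x. ?c * Q n (\<lambda>_. 1) x) \<in> bmeas E" by (intro bmeas_mult Q1 bmeas_const)
      show "Q n f x \<le> ?c * Q n (\<lambda>_. 1) x" if "x \<in> space E" for x
      proof -
        have "Q n f x / Q n (\<lambda>_. 1) x \<le> ?c" using osc[OF that y] by simp
        then show ?thesis by (simp only: pos_divide_le_eq[OF Q_1_pos[OF that]])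
      qed
    qed
    then have "(\<integral>x. Q n f x \<partial>\<mu>) \<le> ?c * (\<integral>x. Q n (\<lambda>_. 1) x \<partial>\<mu>)" by simp
    then have "U \<le> ?c"
      unfolding U_def integral_funpow_fk_Phi[OF \<mu> f]
      by (simp only: pos_divide_le_eq[OF integral_Q_1_pos[OF \<mu>]])
    then show ?thesis by simp
  qed
  then have "(U - d) * Q n (\<lambda>_. 1) y \<le> Q n f y" if "y \<in> space E" for y
    using that pos_le_divide_eq[OF Q_1_pos[OF that, of n]] by blast
  then have "(\<integral>y. (U - d) * Q n (\<lambda>_. 1) y \<partial>\<nu>) \<le> (\<integral>y. Q n f y \<partial>\<nu>)"
    by (intro bmeas_integral_mono[OF \<nu>] bmeas_mult Q1 bmeas_const bmeas_Q f)
  then have "U - d \<le> (\<integral>x. f x \<partial>(fk_Phi M G ^^ n) \<nu>)"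
    unfolding integral_funpow_fk_Phi[OF \<nu> f] by (simp add: pos_le_divide_eq[OF integral_Q_1_pos[OF \<nu>]])
  then show ?thesis by (simp add: U_def)
qed

lemma fk_Phi_contraction:
  assumes \<mu>: "\<mu> \<in> space (prob_algebra E)" and \<nu>: "\<nu> \<in> space (prob_algebra E)"
    and f: "f \<in> bmeas E" "\<And>x. x \<in> space E \<Longrightarrow> \<bar>f x\<bar> \<le> B" and B: "0 < B"
  shows "\<bar>(\<integral>x. f x \<partial>(fk_Phi M G ^^ n) \<mu>) - (\<integral>x. f x \<partial>(fk_Phi M G ^^ n) \<nu>)\<bar>
     \<le> 2 * B * a * exp (- lam * real n)"
proof -
  have osc: "Q n f x / Q n (\<lambda>_. 1) x - Q n f y / Q n (\<lambda>_. 1) y \<le> 2 * B * a * exp (- lam * real n)"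
    if "x \<in> space E" "y \<in> space E" for x y
    using Q_ratio_osc[OF f B that, of n] by linarith
  show ?thesis
    using Q_ratio_average_le[OF \<mu> \<nu> f(1) osc] Q_ratio_average_le[OF \<nu> \<mu> f(1) osc]
    by (simp add: abs_le_iff)
qed

lemma measure_fk_Phi_contraction:
  assumes \<mu>: "\<mu> \<in> space (prob_algebra E)" and \<nu>: "\<nu> \<in> space (prob_algebra E)" and A: "A \<in> sets E"
  shows "\<bar>measure ((fk_Phi M G ^^ n) \<mu>) A - measure ((fk_Phi M G ^^ n) \<nu>) A\<bar>
     \<le> 2 * a * exp (- lam * real n)"
  using fk_Phi_contraction[OF \<mu> \<nu> bmeas_indicator[OF A], of 1 n]
  by (simp add: integral_indicator_prob_algebra[OF funpow_fk_Phi_in_prob_algebra[OF \<mu>] A]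
      integral_indicator_prob_algebra[OF funpow_fk_Phi_in_prob_algebra[OF \<nu>] A]
      del: Bochner_Integration.integral_indicator)

lemma exp_rate_tendsto: "(\<lambda>n. c * exp (- lam * real n)) \<longlonglongrightarrow> 0"
proof -
  have "(\<lambda>n. c * exp (- lam) ^ n) \<longlonglongrightarrow> c * 0"
    using lam_pos by (intro tendsto_intros LIMSEQ_power_zero) simp
  then show ?thesis
    by (simp add: exp_of_nat_mult[symmetric] mult.commute)
qed

lemma fixed_point_unique:
  assumes \<mu>: "\<mu> \<in> space (prob_algebra E)" "\<mu> = fk_Phi M G \<mu>"
    and \<nu>: "\<nu> \<in> space (prob_algebra E)" "\<nu> = fk_Phi M G \<nu>"
  shows "\<mu> = \<nu>"
proof (rule prob_algebra_eqI[OF \<mu>(1) \<nu>(1)])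
  fix A assume A: "A \<in> sets E"
  have fix_iter: "(fk_Phi M G ^^ n) \<rho> = \<rho>" if "\<rho> = fk_Phi M G \<rho>" for n \<rho>
    by (induction n) (simp_all add: that[symmetric])
  have "\<bar>measure \<mu> A - measure \<nu> A\<bar> \<le> 2 * a * exp (- lam * real n)" for n
    using measure_fk_Phi_contraction[OF \<mu>(1) \<nu>(1) A, of n] fix_iter[OF \<mu>(2)] fix_iter[OF \<nu>(2)]
    by simp
  then have "\<bar>measure \<mu> A - measure \<nu> A\<bar> \<le> 0"
    by (intro LIMSEQ_le_const[OF exp_rate_tendsto]) auto
  then show "measure \<mu> A = measure \<nu> A" by simp
qed

text \<open>The orbit of a point mass is Cauchy in total variation. Its limit is fixed because
  \<open>\<Phi>(\<mu>)(A)\<close> is a quotient of two integrals of bounded functions under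
  \<open>\<mu>\<close>, and both converge along the orbit.\<close>

lemma fixed_point_exists: "\<exists>\<eta>. \<eta> \<in> space (prob_algebra E) \<and> \<eta> = fk_Phi M G \<eta>"
proof -
  obtain x where x: "x \<in> space E" using E_nonempty by auto
  define \<mu> where "\<mu> n = (fk_Phi M G ^^ n) (return E x)" for n
  have \<mu>: "\<mu> n \<in> space (prob_algebra E)" for n
    unfolding \<mu>_def by (intro funpow_fk_Phi_in_prob_algebra return_in_prob_algebra x)
  have \<mu>_add: "\<mu> (n + k) = (fk_Phi M G ^^ n) (\<mu> k)" for n k
    by (simp add: \<mu>_def funpow_add)
  \<comment> \<open>Both measures are images under the \<open>n\<close>-th iterate, of
    \<open>\<mu> (m - n)\<close> and of \<open>\<mu> 0\<close>, so the contraction applies with a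
    rate depending on \<open>n\<close> alone.\<close>
  have cauchy: "\<bar>measure (\<mu> m) A - measure (\<mu> n) A\<bar> \<le> 2 * a * exp (- lam * real n)"
    if A: "A \<in> sets E" and "n \<le> m" for A m n
    using measure_fk_Phi_contraction[OF \<mu> \<mu> A, of n "m - n" 0] \<open>n \<le> m\<close>
    by (simp flip: \<mu>_add)
  obtain \<eta> where \<eta>: "\<eta> \<in> space (prob_algebra E)"
    and le: "\<And>A n. A \<in> sets E \<Longrightarrow> \<bar>measure (\<mu> n) A - measure \<eta> A\<bar> \<le> 2 * a * exp (- lam * real n)"
    using prob_algebra_complete[of \<mu> E "\<lambda>n. 2 * a * exp (- lam * real n)",
        OF \<mu> cauchy exp_rate_tendsto] by blast
  \<comment> \<open>Dividing a nonnegative \<open>f\<close> by a bound brings it into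
    \<open>[0, 1]\<close>, where closeness on sets controls the integrals.\<close>
  have lim: "(\<lambda>n. \<integral>x. f x \<partial>\<mu> n) \<longlonglongrightarrow> (\<integral>x. f x \<partial>\<eta>)"
    if f: "f \<in> bmeas E" "\<And>x. x \<in> space E \<Longrightarrow> 0 \<le> f x" for f
  proof -
    obtain B where B: "B > 0" "\<And>x. x \<in> space E \<Longrightarrow> \<bar>f x\<bar> \<le> B"
      using bmeas_bound[OF f(1)] by blast
    have "\<bar>(\<integral>x. f x / B \<partial>\<mu> n) - (\<integral>x. f x / B \<partial>\<eta>)\<bar> \<le> 2 * a * exp (- lam * real n)" for n
      using f(2) B bmeas_divide_const[OF f(1)]
      by (intro integral_diff_le_measure_diff[OF \<mu> \<eta>] le bmeas_measurable) (auto simp: abs_le_iff)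
    then have "(\<lambda>n. (\<integral>x. f x / B \<partial>\<mu> n) - (\<integral>x. f x / B \<partial>\<eta>)) \<longlonglongrightarrow> 0"
      by (intro Lim_null_comparison[OF _ exp_rate_tendsto[of "2 * a"]]) simp
    then have "(\<lambda>n. (\<integral>x. f x / B \<partial>\<mu> n)) \<longlonglongrightarrow> (\<integral>x. f x / B \<partial>\<eta>)"
      by (rule LIM_zero_cancel)
    then have "(\<lambda>n. B * (\<integral>x. f x / B \<partial>\<mu> n)) \<longlonglongrightarrow> B * (\<integral>x. f x / B \<partial>\<eta>)"
      by (intro tendsto_intros)
    then show ?thesis using B by simp
  qed
  have "\<eta> = fk_Phi M G \<eta>"
  proof (rule prob_algebra_eqI[OF \<eta> fk_Phi_in_prob_algebra[OF \<eta>]])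
    fix A assume A: "A \<in> sets E"
    let ?f = "\<lambda>x. G x * kernel_op M (indicator A) x"
    have f: "?f \<in> bmeas E"
      by (intro bmeas_mult bmeas_G bmeas_kernel_op M_kernel bmeas_indicator A)
    have f_nonneg: "0 \<le> ?f x" if "x \<in> space E" for x
      using G_pos[OF that] by (simp add: kernel_op_def)
    have Phi: "measure (fk_Phi M G \<rho>) A = (\<integral>x. ?f x \<partial>\<rho>) / (\<integral>x. G x \<partial>\<rho>)"
      if "\<rho> \<in> space (prob_algebra E)" for \<rho>
      using integral_fk_Phi[OF that bmeas_indicator[OF A]]
        integral_indicator_prob_algebra[OF fk_Phi_in_prob_algebra[OF that] A] by simp
    have "(\<lambda>n. (\<integral>x. ?f x \<partial>\<mu> n) / (\<integral>x. G x \<partial>\<mu> n)) \<longlonglongrightarrow> (\<integral>x. ?f x \<partial>\<eta>) / (\<integral>x. G x \<partial>\<eta>)"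
      using integral_G_pos[OF \<eta>] G_pos f_nonneg
      by (intro tendsto_divide lim f bmeas_G) (auto intro: less_imp_le)
    then have "(\<lambda>n. measure (\<mu> (Suc n)) A) \<longlonglongrightarrow> measure (fk_Phi M G \<eta>) A"
      using Phi[OF \<mu>] Phi[OF \<eta>] by (simp add: \<mu>_def)
    moreover have "(\<lambda>n. measure (\<mu> n) A) \<longlonglongrightarrow> measure \<eta> A"
      using le[OF A] by (intro LIM_zero_cancel[OF Lim_null_comparison[OF _ exp_rate_tendsto[of "2 * a"]]]) simp
    then have "(\<lambda>n. measure (\<mu> (Suc n)) A) \<longlonglongrightarrow> measure \<eta> A"
      by (rule LIMSEQ_Suc)
    ultimately show "measure \<eta> A = measure (fk_Phi M G \<eta>) A"
      by (rule LIMSEQ_unique[rotated])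
  qed
  with \<eta> show ?thesis by blast
qed

lemma
  shows fk_eta_inf_in_prob_algebra: "fk_eta_inf E M G \<in> space (prob_algebra E)"
    and fk_Phi_fk_eta_inf: "fk_Phi M G (fk_eta_inf E M G) = fk_eta_inf E M G"
proof -
  have "\<exists>!\<eta>. \<eta> \<in> space (prob_algebra E) \<and> \<eta> = fk_Phi M G \<eta>"
    using fixed_point_exists fixed_point_unique by blast
  from theI'[OF this, folded fk_eta_inf_def]
  show "fk_eta_inf E M G \<in> space (prob_algebra E)" "fk_Phi M G (fk_eta_inf E M G) = fk_eta_inf E M G"
    by (rule conjunct1, rule conjunct2[THEN sym])
qed

lemma funpow_fk_Phi_fk_eta_inf: "(fk_Phi M G ^^ n) (fk_eta_inf E M G) = fk_eta_inf E M G"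
  by (induction n) (auto simp: fk_Phi_fk_eta_inf)

end

section \<open>The function h\<close>

lemma abs_ln_diff_le:
  fixes u v c :: real
  assumes "0 < c" "c \<le> u" "c \<le> v"
  shows "\<bar>ln u - ln v\<bar> \<le> \<bar>u - v\<bar> / c"
proof -
  have *: "ln u - ln v \<le> \<bar>u - v\<bar> / c" if "c \<le> u" "c \<le> v" for u v
  proof -
    have "ln u - ln v \<le> (u - v) / v"
      using that assms(1) by (intro ln_diff_le) auto
    also have "\<dots> \<le> \<bar>u - v\<bar> / c"
      using that assms(1) by (intro frac_le) auto
    finally show ?thesis .
  qed
  show ?thesis
    using *[OF assms(2,3)] *[OF assms(3,2)] by (simp add: abs_le_iff abs_minus_commute)
qed

lemma abs_exp_diff_le:
  fixes u v c :: real
  assumes "u \<le> c" "v \<le> c"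
  shows "\<bar>exp u - exp v\<bar> \<le> exp c * \<bar>u - v\<bar>"
proof -
  have *: "exp u - exp v \<le> exp c * \<bar>u - v\<bar>" if "u \<le> c" for u v :: real
  proof (cases "v \<le> u")
    case True
    have "exp u - exp v = exp u * (1 - exp (v - u))"
      by (simp add: right_diff_distrib flip: exp_add)
    also have "1 - exp (v - u) \<le> u - v"
      using exp_ge_add_one_self[of "v - u"] by linarith
    then have "exp u * (1 - exp (v - u)) \<le> exp u * (u - v)"
      by (rule mult_left_mono) simp
    also have "\<dots> \<le> exp c * (u - v)"
      using that True by (intro mult_right_mono) auto
    finally show ?thesis using True by simp
  next
    case False
    then have "exp u - exp v \<le> 0" by simp
    also have "0 \<le> exp c * \<bar>u - v\<bar>" by simp
    finally show ?thesis .
  qed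
  show ?thesis
    using *[OF assms(1), of v] *[OF assms(2), of u] by (simp add: abs_le_iff abs_minus_commute)
qed

lemma abs_suminf_tail_le:
  fixes t :: "nat \<Rightarrow> real"
  assumes t: "\<And>n. \<bar>t n\<bar> \<le> c * r ^ n" and r: "0 \<le> r" "r < 1"
  shows "summable t" "\<bar>suminf t - (\<Sum>n<N. t n)\<bar> \<le> c / (1 - r) * r ^ N"
    "\<bar>\<Sum>n<N. t n\<bar> \<le> c / (1 - r)"
proof -
  have geo: "(\<lambda>n. c * r ^ N * r ^ n) sums (c * r ^ N * (1 / (1 - r)))" for N
    using r by (intro sums_mult geometric_sums) simp
  have t': "norm (t (n + N)) \<le> c * r ^ N * r ^ n" for n N
    using t[of "n + N"] by (simp add: power_add ac_simps)
  show summable: "summable t"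
    using summable_comparison_test'[OF sums_summable[OF geo[of 0]], of 0 t] t' [of _ 0] by simp
  have tail: "\<bar>\<Sum>n. t (n + N)\<bar> \<le> c / (1 - r) * r ^ N" for N
    using norm_suminf_le[OF t' sums_summable[OF geo]] sums_unique[OF geo, of N] by simp
  show "\<bar>suminf t - (\<Sum>n<N. t n)\<bar> \<le> c / (1 - r) * r ^ N"
    using suminf_split_initial_segment[OF summable, of N] tail[of N] by simp
  have c: "0 \<le> c"
    using order_trans[OF abs_ge_zero t[of 0]] by simp
  have "\<bar>\<Sum>n<N. t n\<bar> \<le> (\<Sum>n<N. c * r ^ n)"
    by (intro order_trans[OF sum_abs] sum_mono t)
  also have "\<dots> \<le> (\<Sum>n. c * r ^ n)"
    using geo[of 0] r c by (intro sum_le_suminf) (auto simp: sums_iff)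
  also have "\<dots> = c / (1 - r)"
    using sums_unique[OF geo[of 0]] by simp
  finally show "\<bar>\<Sum>n<N. t n\<bar> \<le> c / (1 - r)" .
qed

section \<open>Convergence of the normalised semigroup to \<open>h\<close>\<close>

context stable_feynman_kac
begin

definition r :: real where "r = exp (- lam)"

lemma r_bounds: "0 < r" "r < 1"
  using lam_pos by (simp_all add: r_def)

lemma exp_rate: "exp (- lam * real n) = r ^ n" "exp (- (lam * real n)) = r ^ n"
  by (simp_all add: r_def exp_of_nat_mult[symmetric] mult.commute)

text \<open>Members of \<open>Osc E\<close> have no common supremum bound. Subtracting the value at
  one point leaves the difference of the integrals unchanged and makes the function bounded by
  \<open>1\<close>.\<close>

lemma contraction_Osc:
  assumes \<mu>: "\<mu> \<in> space (prob_algebra E)" and \<nu>: "\<nu> \<in> space (prob_algebra E)" and f: "f \<in> Osc E"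
  shows "\<bar>(\<integral>x. f x \<partial>(fk_Phi M G ^^ n) \<mu>) - (\<integral>x. f x \<partial>(fk_Phi M G ^^ n) \<nu>)\<bar> \<le> 2 * a * r ^ n"
proof -
  obtain y where y: "y \<in> space E" using E_nonempty by auto
  let ?f = "\<lambda>x. f x - f y"
  have I: "(\<integral>x. ?f x \<partial>\<rho>) = (\<integral>x. f x \<partial>\<rho>) - f y" if "\<rho> \<in> space (prob_algebra E)" for \<rho>
    unfolding bmeas_integral_diff[OF that Osc_bmeas[OF f] bmeas_const]
    by (simp only: prob_algebra_integral_const[OF that])
  have "?f \<in> bmeas E"
    by (intro bmeas_diff Osc_bmeas f bmeas_const)
  from fk_Phi_contraction[OF \<mu> \<nu> this OscD[OF f _ y], of n] show ?thesis
    by (simp add: I[OF funpow_fk_Phi_in_prob_algebra] \<mu> \<nu> exp_rate)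
qed

abbreviation \<eta>\<^sub>i :: "'a measure" where "\<eta>\<^sub>i \<equiv> fk_eta_inf E M G"

text \<open>By the fixed point equation \<open>\<eta>\<^sub>i\<close> is a left eigenmeasure of
  \<open>f \<mapsto> G \<cdot> M f\<close>, and \<open>\<rho>\<close> is its eigenvalue.\<close>

definition \<rho> :: real where "\<rho> = (\<integral>x. G x \<partial>\<eta>\<^sub>i)"

text \<open>The finite-time approximations of \<open>h\<close>, scaled so that each has integral
  \<open>1\<close> under \<open>\<eta>\<^sub>i\<close>.\<close>

definition H :: "nat \<Rightarrow> 'a \<Rightarrow> real" where "H n x = Q n (\<lambda>_. 1) x / \<rho> ^ n"

text \<open>The sum of the geometric series that dominates the series for \<open>log h\<close>; it
  bounds \<open>\<bar>log (H n)\<bar>\<close> and \<open>\<bar>log h\<bar>\<close>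
  uniformly.\<close>

definition c\<^sub>0 :: real where "c\<^sub>0 = 2 * g\<^sub>1 * a / g\<^sub>0 / (1 - r)"

lemma \<rho>_ge: "g\<^sub>0 \<le> \<rho>"
  unfolding \<rho>_def using G_bounds
  by (intro bmeas_integral_ge[OF fk_eta_inf_in_prob_algebra bmeas_G]) auto

lemma \<rho>_pos: "0 < \<rho>"
  using \<rho>_ge g\<^sub>0_pos by linarith

lemma Q_G: "x \<in> space E \<Longrightarrow> Q n G x = Q (Suc n) (\<lambda>_. 1) x"
  unfolding Q_Suc_right by (rule Q_cong) (simp_all add: kernel_op_M_1)

lemma bmeas_Q1: "Q n (\<lambda>_. 1) \<in> bmeas E"
  by (intro bmeas_Q bmeas_const)

lemma bmeas_H: "H n \<in> bmeas E"
  unfolding H_def[abs_def] by (intro bmeas_divide_const bmeas_Q1)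

lemma integral_funpow_fk_Phi_G:
  assumes "\<mu> \<in> space (prob_algebra E)"
  shows "(\<integral>x. G x \<partial>(fk_Phi M G ^^ n) \<mu>) = (\<integral>x. Q (Suc n) (\<lambda>_. 1) x \<partial>\<mu>) / (\<integral>x. Q n (\<lambda>_. 1) x \<partial>\<mu>)"
proof -
  have "(\<integral>x. Q n G x \<partial>\<mu>) = (\<integral>x. Q (Suc n) (\<lambda>_. 1) x \<partial>\<mu>)"
    by (rule bmeas_integral_cong[OF assms Q_G])
  then show ?thesis
    by (simp add: integral_funpow_fk_Phi[OF assms bmeas_G])
qed

lemma integral_Q1_eta_inf: "(\<integral>x. Q n (\<lambda>_. 1) x \<partial>\<eta>\<^sub>i) = \<rho> ^ n"
proof (induction n)
  case 0
  show ?case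
    using prob_algebra_integral_const[OF fk_eta_inf_in_prob_algebra, of 1] by simp
next
  case (Suc n)
  show ?case
    using integral_funpow_fk_Phi_G[OF fk_eta_inf_in_prob_algebra, of n] \<rho>_pos
    by (simp add: funpow_fk_Phi_fk_eta_inf Suc.IH \<rho>_def[symmetric] field_simps)
qed

lemma integral_H_eta_inf: "(\<integral>x. H n x \<partial>\<eta>\<^sub>i) = 1"
  unfolding H_def using integral_Q1_eta_inf[of n] \<rho>_pos by simp

lemma g\<^sub>1_pos: "0 < g\<^sub>1"
proof -
  obtain x where "x \<in> space E" using E_nonempty by auto
  with G_bounds[of x] g\<^sub>0_pos show ?thesis by linarith
qed

lemma c\<^sub>0_nonneg: "0 \<le> c\<^sub>0"
  using g\<^sub>0_pos g\<^sub>1_pos a_nonneg r_bounds by (simp add: c\<^sub>0_def)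

text \<open>The \<open>n\<close>-th term of the series is \<open>log (q\<^sub>n\<^sub>+\<^sub>1(x) /
  q\<^sub>n(x)) - log \<rho>\<close>, so partial sums telescope. The terms decay geometrically
  because the flows from \<open>x\<close> and from \<open>\<eta>\<^sub>i\<close> merge at rate
  \<open>r\<close>.\<close>

lemma H_eq_exp:
  assumes x: "x \<in> space E"
  defines "t \<equiv> \<lambda>n. ln (\<integral>y. G y \<partial>(fk_Phi M G ^^ n) (return E x)) - ln (\<integral>y. G y \<partial>(fk_Phi M G ^^ n) \<eta>\<^sub>i)"
  shows "H N x = exp (\<Sum>n<N. t n)" "\<bar>suminf t - (\<Sum>n<N. t n)\<bar> \<le> c\<^sub>0 * r ^ N"
    "\<bar>\<Sum>n<N. t n\<bar> \<le> c\<^sub>0"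
proof -
  note \<delta> = return_in_prob_algebra[OF x]
  have t: "t n = ln (Q (Suc n) (\<lambda>_. 1) x / Q n (\<lambda>_. 1) x) - ln \<rho>" for n
    unfolding t_def integral_funpow_fk_Phi_G[OF \<delta>] funpow_fk_Phi_fk_eta_inf \<rho>_def[symmetric]
    by (simp add: integral_return_bmeas[OF x bmeas_Q1])
  show "H N x = exp (\<Sum>n<N. t n)"
  proof (induction N)
    case (Suc N)
    have "exp (t N) = Q (Suc N) (\<lambda>_. 1) x / Q N (\<lambda>_. 1) x / \<rho>"
      unfolding t exp_diff using Q_1_pos[OF x] \<rho>_pos by simp
    with Suc[symmetric] show ?case
      using Q_1_pos[OF x, of N] by (simp add: exp_add H_def)
  qed (simp add: H_def)
  have t_le: "\<bar>t n\<bar> \<le> 2 * g\<^sub>1 * a / g\<^sub>0 * r ^ n" for n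
  proof -
    let ?u = "\<integral>y. G y \<partial>(fk_Phi M G ^^ n) (return E x)" and ?v = "\<integral>y. G y \<partial>(fk_Phi M G ^^ n) \<eta>\<^sub>i"
    \<comment> \<open>Both integrals are at least \<open>g\<^sub>0\<close>, and there the logarithm
      is Lipschitz with constant \<open>1 / g\<^sub>0\<close>.\<close>
    have "\<bar>t n\<bar> \<le> \<bar>?u - ?v\<bar> / g\<^sub>0"
      unfolding t_def using G_bounds
      by (intro abs_ln_diff_le g\<^sub>0_pos bmeas_integral_ge[where E=E] funpow_fk_Phi_in_prob_algebra \<delta>
            fk_eta_inf_in_prob_algebra bmeas_G) auto
    also have "\<bar>?u - ?v\<bar> \<le> 2 * g\<^sub>1 * a * exp (- lam * real n)"
      using G_bounds G_pos
      by (intro fk_Phi_contraction \<delta> fk_eta_inf_in_prob_algebra bmeas_G g\<^sub>1_pos) (auto simp: abs_of_pos)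
    finally show ?thesis
      using g\<^sub>0_pos by (simp add: divide_right_mono exp_rate)
  qed
  show "\<bar>suminf t - (\<Sum>n<N. t n)\<bar> \<le> c\<^sub>0 * r ^ N" "\<bar>\<Sum>n<N. t n\<bar> \<le> c\<^sub>0"
    unfolding c\<^sub>0_def
    using abs_suminf_tail_le(2,3)[of t "2 * g\<^sub>1 * a / g\<^sub>0" r, OF t_le] r_bounds by simp_all
qed

lemma H_bounds:
  assumes x: "x \<in> space E"
  shows "exp (- c\<^sub>0) \<le> H n x" "H n x \<le> exp c\<^sub>0"
  using H_eq_exp(1,3)[OF x, of n] by auto

text \<open>Below \<open>c\<^sub>0\<close> the exponential is Lipschitz with constant
  \<open>exp c\<^sub>0\<close>, so the tail of the series for \<open>log h\<close> carries over to
  \<open>h\<close> itself.\<close>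

lemma H_tail:
  assumes x: "x \<in> space E"
  shows "\<bar>H n x - fk_h E M G x\<bar> \<le> exp c\<^sub>0 * c\<^sub>0 * r ^ n" "\<bar>fk_h E M G x\<bar> \<le> exp c\<^sub>0"
proof -
  define t where "t = (\<lambda>n. ln (\<integral>y. G y \<partial>(fk_Phi M G ^^ n) (return E x)) - ln (\<integral>y. G y \<partial>(fk_Phi M G ^^ n) \<eta>\<^sub>i))"
  note t = H_eq_exp[OF x, folded t_def]
  have h: "fk_h E M G x = exp (suminf t)"
    by (simp add: fk_h_def t_def)
  \<comment> \<open>The tail estimate at index \<open>0\<close>, where the partial sum is
    empty.\<close>
  have le: "suminf t \<le> c\<^sub>0"
    using t(2)[of 0] by simp
  show "\<bar>fk_h E M G x\<bar> \<le> exp c\<^sub>0"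
    using le by (simp add: h)
  have "\<bar>H n x - fk_h E M G x\<bar> \<le> exp c\<^sub>0 * \<bar>(\<Sum>k<n. t k) - suminf t\<bar>"
    unfolding h t(1) using le t(3)[of n] by (intro abs_exp_diff_le) auto
  also have "\<dots> \<le> exp c\<^sub>0 * (c\<^sub>0 * r ^ n)"
    using t(2)[of n] by (intro mult_left_mono) (auto simp: abs_minus_commute)
  finally show "\<bar>H n x - fk_h E M G x\<bar> \<le> exp c\<^sub>0 * c\<^sub>0 * r ^ n" by (simp add: ac_simps)
qed

lemma bmeas_fk_h: "fk_h E M G \<in> bmeas E"
proof (rule bmeasI[OF _ H_tail(2)])
  show "fk_h E M G \<in> borel_measurable E"
  proof (rule borel_measurable_LIMSEQ_real)
    show "H n \<in> borel_measurable E" for n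
      by (rule bmeas_measurable[OF bmeas_H])
    show "(\<lambda>n. H n x) \<longlonglongrightarrow> fk_h E M G x" if "x \<in> space E" for x
    proof (rule LIM_zero_cancel, rule Lim_null_comparison)
      show "(\<lambda>n. exp c\<^sub>0 * c\<^sub>0 * r ^ n) \<longlonglongrightarrow> 0"
        using exp_rate_tendsto by (simp only: exp_rate)
      show "\<forall>\<^sub>F n in sequentially. norm (H n x - fk_h E M G x) \<le> exp c\<^sub>0 * c\<^sub>0 * r ^ n"
        using H_tail(1)[OF that] by simp
    qed
  qed
qed

text \<open>The power of \<open>\<rho>\<close> hidden in \<open>H (n - p)\<close> cancels between
  numerator and denominator.\<close>

lemma fk_Qbar_eq:
  assumes \<eta>\<^sub>0: "\<eta>\<^sub>0 \<in> space (prob_algebra E)" and "p \<le> n" and x: "x \<in> space E"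
  shows "fk_Qbar E M G \<eta>\<^sub>0 p n (\<lambda>_. 1) x = H (n - p) x / (\<integral>y. H (n - p) y \<partial>(fk_Phi M G ^^ p) \<eta>\<^sub>0)"
proof -
  have "(\<integral>y. fk_Q E M G p n (\<lambda>_. 1) y \<partial>(fk_Phi M G ^^ p) \<eta>\<^sub>0)
      = (\<integral>y. Q (n - p) (\<lambda>_. 1) y \<partial>(fk_Phi M G ^^ p) \<eta>\<^sub>0)"
    by (rule bmeas_integral_cong[OF funpow_fk_Phi_in_prob_algebra[OF \<eta>\<^sub>0]]) (simp add: fk_Q_eq)
  then show ?thesis
    using \<rho>_pos by (simp add: fk_Qbar_def fk_eta_eq[OF \<eta>\<^sub>0] fk_Q_eq[OF x] H_def)
qed

text \<open>Two errors add up. The denominator \<open>D\<close> differs from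
  \<open>\<eta>\<^sub>i(H\<^sub>n\<^sub>-\<^sub>p) = 1\<close> by order \<open>r ^ p\<close>, since
  the flow at time \<open>p\<close> is near \<open>\<eta>\<^sub>i\<close>; the numerator differs
  from \<open>h\<close> by order \<open>r ^ (n - p)\<close>.\<close>

lemma fk_Qbar_bounds:
  assumes \<eta>\<^sub>0: "\<eta>\<^sub>0 \<in> space (prob_algebra E)" and "p \<le> n" and x: "x \<in> space E"
  shows "\<bar>fk_Qbar E M G \<eta>\<^sub>0 p n (\<lambda>_. 1) x\<bar> \<le> exp (2 * c\<^sub>0)"
    and "\<bar>fk_Qbar E M G \<eta>\<^sub>0 p n (\<lambda>_. 1) x - fk_h E M G x\<bar>
      \<le> exp (2 * c\<^sub>0) * (2 * exp c\<^sub>0 * a) * r ^ p + exp c\<^sub>0 * c\<^sub>0 * r ^ (n - p)"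
proof -
  define D where "D = (\<integral>y. H (n - p) y \<partial>(fk_Phi M G ^^ p) \<eta>\<^sub>0)"
  let ?H = "H (n - p) x"
  have D_ge: "exp (- c\<^sub>0) \<le> D"
    unfolding D_def
    by (rule bmeas_integral_ge[OF funpow_fk_Phi_in_prob_algebra[OF \<eta>\<^sub>0] bmeas_H H_bounds(1)])
  then have D: "0 < D"
    using exp_gt_zero[of "- c\<^sub>0"] by linarith
  have H_pos: "0 < ?H"
    using H_bounds(1)[OF x, of "n - p"] exp_gt_zero[of "- c\<^sub>0"] by linarith
  have "?H / D \<le> exp c\<^sub>0 / exp (- c\<^sub>0)"
    using D_ge H_bounds(2)[OF x] by (intro frac_le) auto
  also have "\<dots> = exp (2 * c\<^sub>0)"
    by (simp flip: exp_diff)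
  finally have HD: "?H / D \<le> exp (2 * c\<^sub>0)" .
  have "\<bar>H k y\<bar> \<le> exp c\<^sub>0" if "y \<in> space E" for y k
    using H_bounds[OF that, of k] exp_gt_zero[of "- c\<^sub>0"] by linarith
  from fk_Phi_contraction[OF \<eta>\<^sub>0 fk_eta_inf_in_prob_algebra bmeas_H this, of p "n - p"]
  have D1: "\<bar>D - 1\<bar> \<le> 2 * exp c\<^sub>0 * a * r ^ p"
    by (simp add: D_def funpow_fk_Phi_fk_eta_inf integral_H_eta_inf exp_rate)
  have Qbar: "fk_Qbar E M G \<eta>\<^sub>0 p n (\<lambda>_. 1) x = ?H / D"
    unfolding D_def by (rule fk_Qbar_eq[OF assms])
  show "\<bar>fk_Qbar E M G \<eta>\<^sub>0 p n (\<lambda>_. 1) x\<bar> \<le> exp (2 * c\<^sub>0)"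
    using HD H_pos D by (simp add: Qbar)
  have "?H / D - ?H = ?H / D * (1 - D)"
    using D by (simp add: right_diff_distrib)
  then have "\<bar>?H / D - ?H\<bar> = ?H / D * \<bar>D - 1\<bar>"
    using H_pos D by (simp add: abs_mult abs_minus_commute)
  also have "\<dots> \<le> exp (2 * c\<^sub>0) * (2 * exp c\<^sub>0 * a * r ^ p)"
    using HD D1 by (intro mult_mono) auto
  finally show "\<bar>fk_Qbar E M G \<eta>\<^sub>0 p n (\<lambda>_. 1) x - fk_h E M G x\<bar>
      \<le> exp (2 * c\<^sub>0) * (2 * exp c\<^sub>0 * a) * r ^ p + exp c\<^sub>0 * c\<^sub>0 * r ^ (n - p)"
    using H_tail(1)[OF x, of "n - p"] unfolding Qbar mult.assoc by linarith
qed

lemma bmeas_fk_Qbar: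
  assumes \<eta>\<^sub>0: "\<eta>\<^sub>0 \<in> space (prob_algebra E)" and "p \<le> n"
  shows "fk_Qbar E M G \<eta>\<^sub>0 p n (\<lambda>_. 1) \<in> bmeas E"
proof (rule bmeasI[OF _ fk_Qbar_bounds(1)[OF assms]])
  have "(\<lambda>x. H (n - p) x / (\<integral>y. H (n - p) y \<partial>(fk_Phi M G ^^ p) \<eta>\<^sub>0)) \<in> borel_measurable E"
    by (intro bmeas_measurable bmeas_divide_const bmeas_H)
  then show "fk_Qbar E M G \<eta>\<^sub>0 p n (\<lambda>_. 1) \<in> borel_measurable E"
    by (rule measurable_cong[THEN iffD1, rotated]) (rule fk_Qbar_eq[OF assms, symmetric])
qed

end

section \<open>Covariances\<close>

lemma kernel_cov_bmeas:
  assumes "L \<in> E \<rightarrow>\<^sub>M prob_algebra E" "f \<in> bmeas E"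
  shows "(\<lambda>x. kernel_op L (\<lambda>y. f y * f y) x - kernel_op L f x * kernel_op L f x) \<in> bmeas E"
  using assms by (intro bmeas_diff bmeas_mult bmeas_kernel_op)

lemma abs_mult_self_le:
  fixes u B :: real
  assumes "\<bar>u\<bar> \<le> B"
  shows "\<bar>u * u\<bar> \<le> B * B"
  unfolding abs_mult using assms by (intro mult_mono) auto

lemma abs_mult_self_diff_le:
  fixes u v B d :: real
  assumes "\<bar>u\<bar> \<le> B" "\<bar>v\<bar> \<le> B" "\<bar>u - v\<bar> \<le> d"
  shows "\<bar>u * u - v * v\<bar> \<le> 2 * B * d"
proof -
  have "u * u - v * v = (u + v) * (u - v)" by (simp add: algebra_simps)
  then show ?thesis
    using assms by (auto simp: abs_mult intro!: mult_mono)
qed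

lemma kernel_variance_abs_le:
  assumes L: "L \<in> E \<rightarrow>\<^sub>M prob_algebra E" and f: "f \<in> bmeas E"
    "\<And>x. x \<in> space E \<Longrightarrow> \<bar>f x\<bar> \<le> B" and x: "x \<in> space E"
  shows "\<bar>kernel_op L (\<lambda>y. f y * f y) x - kernel_op L f x * kernel_op L f x\<bar> \<le> 2 * (B * B)"
  using kernel_op_abs_le[OF L bmeas_mult[OF f(1) f(1)] abs_mult_self_le[OF f(2)] x]
    abs_mult_self_le[OF kernel_op_abs_le[OF L f x]] by linarith

lemma kernel_cov_abs_le:
  assumes \<mu>: "\<mu> \<in> space (prob_algebra E)" and L: "L \<in> E \<rightarrow>\<^sub>M prob_algebra E"
    and f: "f \<in> bmeas E" "\<And>x. x \<in> space E \<Longrightarrow> \<bar>f x\<bar> \<le> B"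
  shows "\<bar>kernel_cov L \<mu> f f\<bar> \<le> 2 * (B * B)"
  unfolding kernel_cov_def
  by (rule bmeas_integral_abs_le[OF \<mu> kernel_cov_bmeas[OF L f(1)] kernel_variance_abs_le[OF L f]])

text \<open>Function, kernel and measure are exchanged in turn, at costs governed by
  \<open>d\<close>, by \<open>e\<^sub>1\<close> and \<open>e\<^sub>2\<close>, and by
  \<open>e\<^sub>3\<close>. Squares are compared through \<open>(u + v) * (u - v)\<close>, whence
  the factors \<open>2 * B\<close>.\<close>

lemma kernel_cov_diff_le:
  fixes E :: "'a measure"
  assumes \<mu>: "\<mu> \<in> space (prob_algebra E)" and \<nu>: "\<nu> \<in> space (prob_algebra E)"
    and L: "L \<in> E \<rightarrow>\<^sub>M prob_algebra E" and L': "L' \<in> E \<rightarrow>\<^sub>M prob_algebra E"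
    and f: "f \<in> bmeas E" "\<And>x. x \<in> space E \<Longrightarrow> \<bar>f x\<bar> \<le> B"
    and h: "h \<in> bmeas E" "\<And>x. x \<in> space E \<Longrightarrow> \<bar>h x\<bar> \<le> B"
    and fh: "\<And>x. x \<in> space E \<Longrightarrow> \<bar>f x - h x\<bar> \<le> d"
    and LL'_h: "\<And>x. x \<in> space E \<Longrightarrow> \<bar>kernel_op L h x - kernel_op L' h x\<bar> \<le> e\<^sub>1"
    and LL'_hh: "\<And>x. x \<in> space E \<Longrightarrow>
      \<bar>kernel_op L (\<lambda>y. h y * h y) x - kernel_op L' (\<lambda>y. h y * h y) x\<bar> \<le> e\<^sub>2"
    and \<mu>\<nu>: "\<bar>(\<integral>x. kernel_op L' (\<lambda>y. h y * h y) x - kernel_op L' h x * kernel_op L' h x \<partial>\<mu>)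
      - (\<integral>x. kernel_op L' (\<lambda>y. h y * h y) x - kernel_op L' h x * kernel_op L' h x \<partial>\<nu>)\<bar> \<le> e\<^sub>3"
  shows "\<bar>kernel_cov L \<mu> f f - kernel_cov L' \<nu> h h\<bar> \<le> 2 * B * d + e\<^sub>2 + 2 * B * (d + e\<^sub>1) + e\<^sub>3"
proof -
  define v where "v = (\<lambda>L f (x::'a). kernel_op L (\<lambda>y. f y * f y) x - kernel_op L f x * kernel_op L f x)"
  have ff: "(\<lambda>y. f y * f y) \<in> bmeas E" and hh: "(\<lambda>y. h y * h y) \<in> bmeas E"
    using f h by (auto intro: bmeas_mult)
  have op_diff: "kernel_op L u x - kernel_op L w x = kernel_op L (\<lambda>y. u y - w y) x"
    if "u \<in> bmeas E" "w \<in> bmeas E" "x \<in> space E" for u w x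
    using bmeas_integral_diff[OF kernel_in_prob_algebra[OF L that(3)] that(1,2)]
    by (simp add: kernel_op_def)
  have "\<bar>v L f x - v L' h x\<bar> \<le> 2 * B * d + e\<^sub>2 + 2 * B * (d + e\<^sub>1)" if x: "x \<in> space E" for x
  proof -
    have "\<bar>kernel_op L (\<lambda>y. f y * f y) x - kernel_op L (\<lambda>y. h y * h y) x\<bar> \<le> 2 * B * d"
      unfolding op_diff[OF ff hh x]
      by (intro kernel_op_abs_le[OF L _ _ x] bmeas_diff ff hh abs_mult_self_diff_le f h fh)
    moreover have "\<bar>kernel_op L f x - kernel_op L h x\<bar> \<le> d"
      unfolding op_diff[OF f(1) h(1) x]
      by (intro kernel_op_abs_le[OF L _ _ x] bmeas_diff f h fh)
    then have "\<bar>kernel_op L f x - kernel_op L' h x\<bar> \<le> d + e\<^sub>1"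
      using LL'_h[OF x] by linarith
    then have "\<bar>kernel_op L f x * kernel_op L f x - kernel_op L' h x * kernel_op L' h x\<bar> \<le> 2 * B * (d + e\<^sub>1)"
      by (intro abs_mult_self_diff_le kernel_op_abs_le[OF L f x] kernel_op_abs_le[OF L' h x])
    ultimately show ?thesis
      using LL'_hh[OF x] unfolding v_def by linarith
  qed
  moreover have v: "v L f \<in> bmeas E" "v L' h \<in> bmeas E"
    unfolding v_def by (rule kernel_cov_bmeas[OF L f(1)], rule kernel_cov_bmeas[OF L' h(1)])
  ultimately have "\<bar>(\<integral>x. v L f x \<partial>\<mu>) - (\<integral>x. v L' h x \<partial>\<mu>)\<bar> \<le> 2 * B * d + e\<^sub>2 + 2 * B * (d + e\<^sub>1)"
    unfolding bmeas_integral_diff[OF \<mu> v, symmetric]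
    by (intro bmeas_integral_abs_le[OF \<mu>] bmeas_diff)
  moreover have "\<bar>(\<integral>x. v L' h x \<partial>\<mu>) - (\<integral>x. v L' h x \<partial>\<nu>)\<bar> \<le> e\<^sub>3"
    unfolding v_def by (rule \<mu>\<nu>)
  moreover have "kernel_cov L \<mu> f f = (\<integral>x. v L f x \<partial>\<mu>)" "kernel_cov L' \<nu> h h = (\<integral>x. v L' h x \<partial>\<nu>)"
    by (simp_all add: kernel_cov_def v_def)
  ultimately show ?thesis by linarith
qed

lemma sum_geometric_both_ends_le:
  fixes r :: real
  assumes r: "0 \<le> r" "r < 1"
  shows "(\<Sum>p<n. r ^ p + r ^ (n - p)) \<le> 2 / (1 - r)"
proof -
  have *: "(\<Sum>p<n. r ^ p) \<le> 1 / (1 - r)"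
    using sum_le_suminf[of "\<lambda>p. r ^ p" "{..<n}"] r suminf_geometric[of r] by simp
  \<comment> \<open>Lowering the exponent by one only increases the terms and makes the sum an exact
    reversal of the geometric one.\<close>
  have "(\<Sum>p<n. r ^ (n - p)) \<le> (\<Sum>p<n. r ^ (n - Suc p))"
    using r by (intro sum_mono power_decreasing) auto
  also have "\<dots> = (\<Sum>p<n. r ^ p)"
    by (rule sum.nat_diff_reindex)
  finally show ?thesis
    using * by (simp add: sum.distrib)
qed

section \<open>Convergence rate of the covariances along the flow\<close>

locale feynman_kac_mckean = stable_feynman_kac +
  fixes K :: "'a measure \<Rightarrow> 'a \<Rightarrow> 'a measure"
    and T :: "('a \<Rightarrow> real) \<Rightarrow> 'a measure \<Rightarrow> 'a \<Rightarrow> real" and \<kappa> :: real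
  assumes K_kernel: "\<And>\<mu>. \<mu> \<in> space (prob_algebra E) \<Longrightarrow> K \<mu> \<in> E \<rightarrow>\<^sub>M prob_algebra E"
    and T_Osc: "\<And>f \<mu>. f \<in> Osc E \<Longrightarrow> \<mu> \<in> space (prob_algebra E) \<Longrightarrow> T f \<mu> \<in> Osc E"
    and K_regular: "\<And>\<mu>\<^sub>1 \<mu>\<^sub>2 f. \<mu>\<^sub>1 \<in> space (prob_algebra E) \<Longrightarrow> \<mu>\<^sub>2 \<in> space (prob_algebra E) \<Longrightarrow>
      f \<in> Osc E \<Longrightarrow>
      sup_norm E (\<lambda>x. kernel_op (K \<mu>\<^sub>1) f x - kernel_op (K \<mu>\<^sub>2) f x)
        \<le> ereal (\<kappa> * \<bar>(\<integral>x. T f \<mu>\<^sub>2 x \<partial>\<mu>\<^sub>1) - (\<integral>x. T f \<mu>\<^sub>2 x \<partial>\<mu>\<^sub>2)\<bar>)"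
begin

text \<open>With \<open>\<eta>\<^sub>i\<close> as the second measure in \<open>K_regular\<close>,
  the test function \<open>T u \<eta>\<^sub>i\<close> does not change along the flow, so the
  contraction over \<open>Osc E\<close> applies to it. The constant combines \<open>2 * B\<close>
  from the scaling of \<open>f\<close> with \<open>2 * a\<close> from the contraction.\<close>

lemma kernel_op_K_rate:
  assumes \<eta>\<^sub>0: "\<eta>\<^sub>0 \<in> space (prob_algebra E)"
    and f: "f \<in> bmeas E" "\<And>x. x \<in> space E \<Longrightarrow> \<bar>f x\<bar> \<le> B" and B: "0 < B"
    and x: "x \<in> space E"
  shows "\<bar>kernel_op (K ((fk_Phi M G ^^ n) \<eta>\<^sub>0)) f x - kernel_op (K \<eta>\<^sub>i) f x\<bar>
    \<le> 4 * B * \<bar>\<kappa>\<bar> * a * r ^ n"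
proof -
  define \<mu> where "\<mu> = (fk_Phi M G ^^ n) \<eta>\<^sub>0"
  define u where "u = (\<lambda>x. f x / (2 * B))"
  have u: "u \<in> Osc E"
    unfolding u_def by (rule bmeas_normalize_Osc[OF f(1) B f(2)])
  have \<mu>: "\<mu> \<in> space (prob_algebra E)"
    unfolding \<mu>_def by (rule funpow_fk_Phi_in_prob_algebra[OF \<eta>\<^sub>0])
  let ?d = "\<bar>(\<integral>x. T u \<eta>\<^sub>i x \<partial>\<mu>) - (\<integral>x. T u \<eta>\<^sub>i x \<partial>\<eta>\<^sub>i)\<bar>"
  have "ereal \<bar>kernel_op (K \<mu>) u x - kernel_op (K \<eta>\<^sub>i) u x\<bar>
      \<le> sup_norm E (\<lambda>x. kernel_op (K \<mu>) u x - kernel_op (K \<eta>\<^sub>i) u x)"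
    unfolding sup_norm_def by (rule SUP_upper[OF x])
  also have "\<dots> \<le> ereal (\<kappa> * ?d)"
    by (rule K_regular[OF \<mu> fk_eta_inf_in_prob_algebra u])
  finally have "\<bar>kernel_op (K \<mu>) u x - kernel_op (K \<eta>\<^sub>i) u x\<bar> \<le> \<kappa> * ?d" by simp
  \<comment> \<open>The absolute value makes the factor nonnegative, as multiplying the contraction
    bound by it requires.\<close>
  also have "\<dots> \<le> \<bar>\<kappa>\<bar> * ?d"
    by (intro mult_right_mono) auto
  also have "\<dots> \<le> \<bar>\<kappa>\<bar> * (2 * a * r ^ n)"
    using contraction_Osc[OF \<eta>\<^sub>0 fk_eta_inf_in_prob_algebra T_Osc[OF u fk_eta_inf_in_prob_algebra], of n]
    by (intro mult_left_mono) (simp_all add: \<mu>_def funpow_fk_Phi_fk_eta_inf)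
  finally have le: "\<bar>kernel_op (K \<mu>) u x - kernel_op (K \<eta>\<^sub>i) u x\<bar> \<le> \<bar>\<kappa>\<bar> * (2 * a * r ^ n)" .
  have "kernel_op L u x = kernel_op L f x / (2 * B)" for L
    by (simp add: kernel_op_def u_def)
  then have "\<bar>kernel_op (K \<mu>) f x - kernel_op (K \<eta>\<^sub>i) f x\<bar> / (2 * B) \<le> \<bar>\<kappa>\<bar> * (2 * a * r ^ n)"
    using le B by (simp flip: diff_divide_distrib)
  then show ?thesis
    using B by (simp add: \<mu>_def pos_divide_le_eq ac_simps)
qed

lemma fk_Cov_rate:
  assumes \<eta>\<^sub>0: "\<eta>\<^sub>0 \<in> space (prob_algebra E)"
  obtains C where "\<And>p n. p \<le> n \<Longrightarrow>
    \<bar>fk_Cov K \<eta>\<^sub>0 p (fk_eta_prev E M G \<eta>\<^sub>0 p) (fk_Qbar E M G \<eta>\<^sub>0 p n (\<lambda>_. 1)) (fk_Qbar E M G \<eta>\<^sub>0 p n (\<lambda>_. 1))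
      - fk_Cov_hom K \<eta>\<^sub>i (fk_h E M G) (fk_h E M G)\<bar> \<le> C * (r ^ p + r ^ (n - p))"
proof -
  define B where "B = exp (2 * c\<^sub>0)"
  define h where "h = fk_h E M G"
  define D where "D = exp (2 * c\<^sub>0) * (2 * exp c\<^sub>0 * a) + exp c\<^sub>0 * c\<^sub>0"
  \<comment> \<open>The summands pay, in order, for time \<open>0\<close>, for replacing the
    normalised semigroup by \<open>h\<close>, and for exchanging kernel and measure. The last error
    has order \<open>r ^ (p - 1)\<close>, because the covariance at time \<open>p\<close> is taken
    at the flow of time \<open>p - 1\<close>; hence the division by \<open>r\<close>.\<close>
  define C where "C = 4 * (B * B) + 4 * B * D + (4 * (B * B) * \<bar>\<kappa>\<bar> * a + 2 * B * (4 * B * \<bar>\<kappa>\<bar> * a) + 4 * (B * B) * a) / r"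
  have B: "0 < B" by (simp add: B_def)
  have D: "0 \<le> D" using a_nonneg c\<^sub>0_nonneg by (simp add: D_def)
  have h: "h \<in> bmeas E" unfolding h_def by (rule bmeas_fk_h)
  have h_le: "\<bar>h x\<bar> \<le> B" if "x \<in> space E" for x
    unfolding h_def B_def using c\<^sub>0_nonneg by (intro order_trans[OF H_tail(2)[OF that]]) simp
  note \<eta>\<^sub>i = fk_eta_inf_in_prob_algebra
  note K_i = K_kernel[OF \<eta>\<^sub>i]
  have Cov_h: "\<bar>kernel_cov (K \<eta>\<^sub>i) \<eta>\<^sub>i h h\<bar> \<le> 2 * (B * B)"
    by (rule kernel_cov_abs_le[OF \<eta>\<^sub>i K_i h h_le])
  show ?thesis
  proof
    fix p n :: nat assume "p \<le> n"
    define f where "f = fk_Qbar E M G \<eta>\<^sub>0 p n (\<lambda>_. 1)"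
    have f: "f \<in> bmeas E"
      unfolding f_def by (rule bmeas_fk_Qbar[OF \<eta>\<^sub>0 \<open>p \<le> n\<close>])
    have f_le: "\<bar>f x\<bar> \<le> B" if "x \<in> space E" for x
      unfolding f_def B_def by (rule fk_Qbar_bounds(1)[OF \<eta>\<^sub>0 \<open>p \<le> n\<close> that])
    define s where "s = r ^ p + r ^ (n - p)"
    have s: "r ^ p \<le> s" "r ^ (n - p) \<le> s" "0 \<le> s"
      using r_bounds by (simp_all add: s_def)
    have fh: "\<bar>f x - h x\<bar> \<le> D * s" if "x \<in> space E" for x
    proof -
      have "\<bar>f x - h x\<bar> \<le> exp (2 * c\<^sub>0) * (2 * exp c\<^sub>0 * a) * r ^ p + exp c\<^sub>0 * c\<^sub>0 * r ^ (n - p)"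
        unfolding f_def h_def by (rule fk_Qbar_bounds(2)[OF \<eta>\<^sub>0 \<open>p \<le> n\<close> that])
      also have "\<dots> \<le> exp (2 * c\<^sub>0) * (2 * exp c\<^sub>0 * a) * s + exp c\<^sub>0 * c\<^sub>0 * s"
        using s a_nonneg c\<^sub>0_nonneg by (intro add_mono mult_left_mono) auto
      also have "\<dots> = D * s" by (simp add: D_def distrib_right)
      finally show ?thesis .
    qed
    have "\<bar>fk_Cov K \<eta>\<^sub>0 p (fk_eta_prev E M G \<eta>\<^sub>0 p) f f - kernel_cov (K \<eta>\<^sub>i) \<eta>\<^sub>i h h\<bar> \<le> C * s"
    proof (cases p)
      case 0
      \<comment> \<open>At time \<open>0\<close> the kernel is the constant law
        \<open>\<eta>\<^sub>0\<close>, which need not be close to \<open>K \<eta>\<^sub>i\<close>. A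
        crude bound suffices because \<open>s \<ge> r ^ 0 = 1\<close>.\<close>
      have "\<bar>kernel_cov (\<lambda>_. \<eta>\<^sub>0) \<eta>\<^sub>0 f f\<bar> \<le> 2 * (B * B)"
        using \<eta>\<^sub>0 by (intro kernel_cov_abs_le[OF \<eta>\<^sub>0 _ f f_le]) simp
      then have "\<bar>fk_Cov K \<eta>\<^sub>0 p (fk_eta_prev E M G \<eta>\<^sub>0 p) f f - kernel_cov (K \<eta>\<^sub>i) \<eta>\<^sub>i h h\<bar> \<le> 4 * (B * B)"
        using Cov_h 0 by (simp add: fk_Cov_def fk_eta_prev_def mckean_kernel_def)
      also have "\<dots> \<le> C"
        using B D a_nonneg r_bounds by (simp add: C_def)
      also have "C \<le> C * s"
        using order_trans[OF _ \<open>4 * (B * B) \<le> C\<close>, of 0] s(1) 0 mult_left_mono[of 1 s C] by simp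
      finally show ?thesis .
    next
      case (Suc m)
      let ?\<mu> = "(fk_Phi M G ^^ m) \<eta>\<^sub>0"
      have \<mu>: "?\<mu> \<in> space (prob_algebra E)"
        by (rule funpow_fk_Phi_in_prob_algebra[OF \<eta>\<^sub>0])
      have rm: "r ^ m \<le> s / r"
        using s(1) r_bounds Suc by (simp add: pos_le_divide_eq mult.commute)
      have BB: "0 < B * B" using B by simp
      let ?v = "\<lambda>x. kernel_op (K \<eta>\<^sub>i) (\<lambda>y. h y * h y) x - kernel_op (K \<eta>\<^sub>i) h x * kernel_op (K \<eta>\<^sub>i) h x"
      have "\<bar>(\<integral>x. ?v x \<partial>?\<mu>) - (\<integral>x. ?v x \<partial>\<eta>\<^sub>i)\<bar> \<le> 2 * (2 * (B * B)) * a * r ^ m"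
        using fk_Phi_contraction[OF \<eta>\<^sub>0 \<eta>\<^sub>i kernel_cov_bmeas[OF K_i h] kernel_variance_abs_le[OF K_i h h_le], of m] BB
        by (simp only: funpow_fk_Phi_fk_eta_inf exp_rate)
      from kernel_cov_diff_le[OF \<mu> \<eta>\<^sub>i K_kernel[OF \<mu>] K_i f f_le h h_le fh
          kernel_op_K_rate[OF \<eta>\<^sub>0 h h_le B]
          kernel_op_K_rate[OF \<eta>\<^sub>0 bmeas_mult[OF h h] abs_mult_self_le[OF h_le] BB] this]
      have "\<bar>kernel_cov (K ?\<mu>) ?\<mu> f f - kernel_cov (K \<eta>\<^sub>i) \<eta>\<^sub>i h h\<bar>
          \<le> 4 * B * D * s + (4 * (B * B) * \<bar>\<kappa>\<bar> * a + 2 * B * (4 * B * \<bar>\<kappa>\<bar> * a) + 4 * (B * B) * a) * r ^ m"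
        by (simp add: algebra_simps)
      also have "\<dots> \<le> 4 * B * D * s + (4 * (B * B) * \<bar>\<kappa>\<bar> * a + 2 * B * (4 * B * \<bar>\<kappa>\<bar> * a) + 4 * (B * B) * a) * (s / r)"
        using rm B a_nonneg by (intro add_left_mono mult_left_mono) auto
      also have "\<dots> = (C - 4 * (B * B)) * s"
        by (simp add: C_def distrib_right)
      also have "\<dots> \<le> C * s"
        using BB s by (intro mult_right_mono) auto
      finally show ?thesis
        using Suc by (simp add: fk_Cov_def fk_eta_prev_def mckean_kernel_def fk_eta_eq[OF \<eta>\<^sub>0])
    qed
    then show "\<bar>fk_Cov K \<eta>\<^sub>0 p (fk_eta_prev E M G \<eta>\<^sub>0 p) (fk_Qbar E M G \<eta>\<^sub>0 p n (\<lambda>_. 1)) (fk_Qbar E M G \<eta>\<^sub>0 p n (\<lambda>_. 1))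
      - fk_Cov_hom K \<eta>\<^sub>i (fk_h E M G) (fk_h E M G)\<bar> \<le> C * (r ^ p + r ^ (n - p))"
      by (simp add: f_def h_def s_def fk_Cov_hom_def)
  qed
qed

text \<open>The individual errors sum to at most \<open>2 * C / (1 - r)\<close> for every
  \<open>n\<close>, so averaging leaves an error of order \<open>1 / n\<close>.\<close>

lemma fk_Cov_average:
  assumes \<eta>\<^sub>0: "\<eta>\<^sub>0 \<in> space (prob_algebra E)"
  shows "(\<lambda>n. (1 / real n) * (\<Sum>p<n. fk_Cov K \<eta>\<^sub>0 p (fk_eta_prev E M G \<eta>\<^sub>0 p)
                (fk_Qbar E M G \<eta>\<^sub>0 p n (\<lambda>_. 1)) (fk_Qbar E M G \<eta>\<^sub>0 p n (\<lambda>_. 1)))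
            - fk_Cov_hom K \<eta>\<^sub>i (fk_h E M G) (fk_h E M G)) \<in> O(\<lambda>n. 1 / real n)"
proof -
  define V where "V = fk_Cov_hom K \<eta>\<^sub>i (fk_h E M G) (fk_h E M G)"
  define v where "v n p = fk_Cov K \<eta>\<^sub>0 p (fk_eta_prev E M G \<eta>\<^sub>0 p)
    (fk_Qbar E M G \<eta>\<^sub>0 p n (\<lambda>_. 1)) (fk_Qbar E M G \<eta>\<^sub>0 p n (\<lambda>_. 1))" for n p
  obtain C where C: "\<And>p n. p \<le> n \<Longrightarrow> \<bar>v n p - V\<bar> \<le> C * (r ^ p + r ^ (n - p))"
    using fk_Cov_rate[OF \<eta>\<^sub>0] unfolding v_def V_def by blast
  \<comment> \<open>The bound at \<open>p = n = 0\<close> reads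
    \<open>\<bar>v 0 0 - V\<bar> \<le> 2 * C\<close>.\<close>
  have "0 \<le> C"
    using order_trans[OF abs_ge_zero C[of 0 0]] by simp
  have "norm (1 / real n * (\<Sum>p<n. v n p) - V) \<le> C * (2 / (1 - r)) * norm (1 / real n)" if "n \<ge> 1" for n
  proof -
    have "(\<Sum>p<n. v n p) - real n * V = (\<Sum>p<n. v n p - V)"
      by (simp add: sum_subtractf)
    also have "\<bar>\<dots>\<bar> \<le> (\<Sum>p<n. C * (r ^ p + r ^ (n - p)))"
      by (intro order_trans[OF sum_abs] sum_mono C) simp
    also have "\<dots> \<le> C * (2 / (1 - r))"
      unfolding sum_distrib_left[symmetric] using r_bounds \<open>0 \<le> C\<close>
      by (intro mult_left_mono sum_geometric_both_ends_le) auto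
    finally have "\<bar>(\<Sum>p<n. v n p) - real n * V\<bar> / real n \<le> C * (2 / (1 - r)) / real n"
      by (rule divide_right_mono) simp
    moreover have "1 / real n * (\<Sum>p<n. v n p) - V = ((\<Sum>p<n. v n p) - real n * V) / real n"
      using that by (simp add: diff_divide_distrib)
    ultimately show ?thesis by simp
  qed
  then show ?thesis
    unfolding v_def V_def by (intro bigoI eventually_mono[OF eventually_ge_at_top[of 1]])
qed

end

section \<open>From the standing assumptions to the locale\<close>

theorem corollary3p4:
  fixes E :: "'a measure"
    and \<eta>\<^sub>0 :: "'a measure"
    and M :: "'a \<Rightarrow> 'a measure"
    and G :: "'a \<Rightarrow> real"
    and K :: "'a measure \<Rightarrow> 'a \<Rightarrow> 'a measure"
    and T :: "('a \<Rightarrow> real) \<Rightarrow> 'a measure \<Rightarrow> 'a \<Rightarrow> real"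
    and a lam \<kappa> :: real
  assumes init: "\<eta>\<^sub>0 \<in> space (prob_algebra E)"
    and kernel: "M \<in> E \<rightarrow>\<^sub>M prob_algebra E"
    and G_meas: "G \<in> borel_measurable E"
    and G_pos: "\<And>x. x \<in> space E \<Longrightarrow> 0 < G x"
    and G_bdd: "bounded (G ` space E)"
    and K_kernel: "\<And>\<mu>. \<mu> \<in> space (prob_algebra E) \<Longrightarrow> K \<mu> \<in> E \<rightarrow>\<^sub>M prob_algebra E"
    and K_Phi: "\<And>\<mu>. \<mu> \<in> space (prob_algebra E) \<Longrightarrow> fk_Phi M G \<mu> = \<mu> \<bind> K \<mu>"
    and G_ratio: "sup_inf_ratio E G < \<infinity>"
    and lambda_pos: "0 < lam"
    and stability: "\<And>p n. p \<le> n \<Longrightarrow>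
      dobrushin E (fk_P E M G p n) \<le> ereal (a * exp (- lam * real (n - p)))"
    and T_Osc: "\<And>f \<mu>. f \<in> Osc E \<Longrightarrow> \<mu> \<in> space (prob_algebra E) \<Longrightarrow> T f \<mu> \<in> Osc E"
    and K_regular: "\<And>\<mu>\<^sub>1 \<mu>\<^sub>2 f. \<mu>\<^sub>1 \<in> space (prob_algebra E) \<Longrightarrow> \<mu>\<^sub>2 \<in> space (prob_algebra E) \<Longrightarrow>
      f \<in> Osc E \<Longrightarrow>
      sup_norm E (\<lambda>x. kernel_op (K \<mu>\<^sub>1) f x - kernel_op (K \<mu>\<^sub>2) f x)
        \<le> ereal (\<kappa> * \<bar>(\<integral>x. T f \<mu>\<^sub>2 x \<partial>\<mu>\<^sub>1) - (\<integral>x. T f \<mu>\<^sub>2 x \<partial>\<mu>\<^sub>2)\<bar>)"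
  shows "(\<lambda>n. (1 / real n) * (\<Sum>p<n. fk_Cov K \<eta>\<^sub>0 p (fk_eta_prev E M G \<eta>\<^sub>0 p)
                (fk_Qbar E M G \<eta>\<^sub>0 p n (\<lambda>_. 1)) (fk_Qbar E M G \<eta>\<^sub>0 p n (\<lambda>_. 1)))
            - fk_Cov_hom K (fk_eta_inf E M G) (fk_h E M G) (fk_h E M G))
         \<in> O(\<lambda>n. 1 / real n)"
proof -
  \<comment> \<open>A space that carries the probability measure \<open>\<eta>\<^sub>0\<close>
    cannot be empty.\<close>
  have E: "space E \<noteq> {}"
    using prob_space.not_empty[OF prob_algebraD(1)[OF init]] prob_algebraD(3)[OF init] by simp
  then obtain y where y: "y \<in> space E" by auto
  obtain g\<^sub>1 where g\<^sub>1: "\<And>x. x \<in> space E \<Longrightarrow> G x \<le> g\<^sub>1"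
    using G_bdd by (force simp: bounded_iff abs_le_iff)
  define i where "i = (INF x\<in>space E. ereal (G x))"
  \<comment> \<open>In \<open>ereal\<close> a positive number divided by \<open>0\<close> is
    \<open>\<infinity>\<close>, so a vanishing infimum would contradict \<open>G_ratio\<close>.
    Together with \<open>i \<le> G y\<close> this makes \<open>i\<close> a positive real, the
    constant \<open>g\<^sub>0\<close>.\<close>
  have "i \<noteq> 0"
  proof
    assume "i = 0"
    have "0 < ereal (G y)" using G_pos[OF y] by simp
    also have "\<dots> \<le> (SUP x\<in>space E. ereal (G x))" by (rule SUP_upper[OF y])
    finally have "sup_inf_ratio E G = \<infinity>"
      using \<open>i = 0\<close> unfolding sup_inf_ratio_def i_def[symmetric] by (simp add: divide_ereal_def)
    with G_ratio show False by simp
  qed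
  moreover have "0 \<le> i"
    unfolding i_def using G_pos by (intro INF_greatest) (auto intro: less_imp_le)
  moreover have i_le: "i \<le> ereal (G x)" if "x \<in> space E" for x
    unfolding i_def by (rule INF_lower[OF that])
  ultimately obtain g\<^sub>0 where g\<^sub>0: "0 < g\<^sub>0" "i = ereal g\<^sub>0"
    using i_le[OF y] by (cases i) (auto simp: zero_ereal_def)
  interpret feynman_kac_mckean E M G g\<^sub>0 g\<^sub>1 a lam K T \<kappa>
  proof
    show "g\<^sub>0 \<le> G x \<and> G x \<le> g\<^sub>1" if "x \<in> space E" for x
      using i_le[OF that] g\<^sub>1[OF that] g\<^sub>0 by simp
  qed (fact kernel G_meas g\<^sub>0(1) lambda_pos stability E K_kernel T_Osc K_regular)+
  show ?thesis
    by (rule fk_Cov_average[OF init])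
qed

end
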